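(* Let $U$ be a $\times_A$-Hopf algebra such that $U_\lhd$ is a projective right $A$-module. Then for all projective left $U$-modules $P,Q$, the left $U$-module $P\otimes Q$ is projective.
   Context: $k$ commutative ring, $A$ a $k$-algebra, $A^e=A\otimes_kA^{\mathrm{op}}$; an $A^e$-algebra is a $k$-algebra $U$ with $\eta:A^e\to U$; left $U$-modules are $A$-bimodules via $a\rhd m\lhd b=\eta(a\otimes b)m$, right $U$-modules via $a\blacktriangleright n\blacktriangleleft b=n\eta(b\otimes a)$. $U\otimes_AU$ is the tensor product of $U_\lhd$ and ${}_\rhd U$; $U\times_AU$ is the subset of $\sum u_i\otimes v_i$ with $\sum a\blacktriangleright u_i\otimes v_i=\sum u_i\otimes v_i\blacktriangleleft a$ for all $a$. A $\times_A$-bialgebra is an $A^e$-algebra $U$ with $A^e$-algebra maps $\hat\Delta:U\to U\times_AU$, $\hat\varepsilon:U\to\mathrm{End}_k(A)$ making $U$, via $\Delta(u)=u_{(1)}\otimes u_{(2)}$ and $\varepsilon(u)=\hat\varepsilon(u)(1)$, a coalgebra in $A$-bimodules. For left $U$-modules $M,N$, $M\otimes N$ is $M\otimes_AN$ with $u(m\otimes n)=u_{(1)}m\otimes u_{(2)}n$. $U$ is a $\times_A$-Hopf algebra if the Galois map ${}_\blacktriangleright U\otimes_{A^{\mathrm{op}}}U_\lhd\to U_\lhd\otimes_A{}_\rhd U$, $u\otimes v\mapsto u_{(1)}\otimes u_{(2)}v$, is bijective (${}_\blacktriangleright U\otimes_{A^{\mathrm{op}}}U_\lhd$ being $U\otimes_kU$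 modulo $a\blacktriangleright u\otimes v-u\otimes v\lhd a$). *)

theory Defs
  imports "HOL-Algebra.Ring" "HOL-Algebra.Module" "HOL-Algebra.RingHom"
begin

definition fsupp :: "('x \<Rightarrow> int) \<Rightarrow> 'x set" where
  "fsupp f = {x. f x \<noteq> 0}"

definition free_ab :: "'x set \<Rightarrow> ('x \<Rightarrow> int) set" where
  "free_ab S = {f. finite (fsupp f) \<and> fsupp f \<subseteq> S}"

definition fdelta :: "'x \<Rightarrow> 'x \<Rightarrow> int" where
  "fdelta x = (\<lambda>y. if y = x then 1 else 0)"

definition fzero :: "'x \<Rightarrow> int" where
  "fzero = (\<lambda>_. 0)"

definition fadd :: "('x \<Rightarrow> int) \<Rightarrow> ('x \<Rightarrow> int) \<Rightarrow> 'x \<Rightarrow> int" where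
  "fadd f g = (\<lambda>x. f x + g x)"

definition fdiff :: "('x \<Rightarrow> int) \<Rightarrow> ('x \<Rightarrow> int) \<Rightarrow> 'x \<Rightarrow> int" where
  "fdiff f g = (\<lambda>x. f x - g x)"

inductive_set zspan :: "('x \<Rightarrow> int) set \<Rightarrow> ('x \<Rightarrow> int) set" for G where
  zspan_zero: "fzero \<in> zspan G"
| zspan_gen: "g \<in> G \<Longrightarrow> g \<in> zspan G"
| zspan_diff: "f \<in> zspan G \<Longrightarrow> g \<in> zspan G \<Longrightarrow> fdiff f g \<in> zspan G"

definition free_lift :: "('x \<Rightarrow> 'y \<Rightarrow> int) \<Rightarrow> ('x \<Rightarrow> int) \<Rightarrow> 'y \<Rightarrow> int" where
  "free_lift g f = (\<lambda>y. \<Sum>x\<in>fsupp f. f x * g x y)"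

definition fmap2 :: "('a \<Rightarrow> 'c) \<Rightarrow> ('b \<Rightarrow> 'd) \<Rightarrow> ('a \<times> 'b \<Rightarrow> int) \<Rightarrow> 'c \<times> 'd \<Rightarrow> int" where
  "fmap2 f g = free_lift (\<lambda>(a, b). fdelta (f a, g b))"

definition feval :: "('b, 'm) ring_scheme \<Rightarrow> ('x \<Rightarrow> 'b) \<Rightarrow> ('x \<Rightarrow> int) \<Rightarrow> 'b" where
  "feval R g f = (\<Oplus>\<^bsub>R\<^esub>x\<in>fsupp f. [f x] \<cdot>\<^bsub>R\<^esub> g x)"

text \<open>M is a right R-module via rm, N a left R-module via ln. The balanced
  tensor product M (x)_R N is the free abelian group on carrier M x carrier N modulo
  the subgroup generated by the following relations.\<close>
definition tens_rel :: "('r, 'c) ring_scheme \<Rightarrow> ('m, 'd) ring_scheme \<Rightarrow> ('m \<Rightarrow> 'r \<Rightarrow> 'm)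
    \<Rightarrow> ('n, 'e) ring_scheme \<Rightarrow> ('r \<Rightarrow> 'n \<Rightarrow> 'n) \<Rightarrow> ('m \<times> 'n \<Rightarrow> int) set" where
  "tens_rel R M rm N ln =
     {fdiff (fdelta (m \<oplus>\<^bsub>M\<^esub> m', n)) (fadd (fdelta (m, n)) (fdelta (m', n))) | m m' n.
        m \<in> carrier M \<and> m' \<in> carrier M \<and> n \<in> carrier N}
   \<union> {fdiff (fdelta (m, n \<oplus>\<^bsub>N\<^esub> n')) (fadd (fdelta (m, n)) (fdelta (m, n'))) | m n n'.
        m \<in> carrier M \<and> n \<in> carrier N \<and> n' \<in> carrier N}
   \<union> {fdiff (fdelta (rm m r, n)) (fdelta (m, ln r n)) | m r n.
        m \<in> carrier M \<and> r \<in> carrier R \<and> n \<in> carrier N}"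

definition tens_eq :: "('r, 'c) ring_scheme \<Rightarrow> ('m, 'd) ring_scheme \<Rightarrow> ('m \<Rightarrow> 'r \<Rightarrow> 'm)
    \<Rightarrow> ('n, 'e) ring_scheme \<Rightarrow> ('r \<Rightarrow> 'n \<Rightarrow> 'n) \<Rightarrow> ('m \<times> 'n \<Rightarrow> int) \<Rightarrow> ('m \<times> 'n \<Rightarrow> int) \<Rightarrow> bool" where
  "tens_eq R M rm N ln x y \<longleftrightarrow>
     x \<in> free_ab (carrier M \<times> carrier N) \<and> y \<in> free_ab (carrier M \<times> carrier N) \<and>
     fdiff x y \<in> zspan (tens_rel R M rm N ln)"

definition tens3_rel :: "('r, 'c) ring_scheme \<Rightarrow> ('a, 'd) ring_scheme \<Rightarrow> ('a \<Rightarrow> 'r \<Rightarrow> 'a)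
    \<Rightarrow> ('b, 'e) ring_scheme \<Rightarrow> ('r \<Rightarrow> 'b \<Rightarrow> 'b) \<Rightarrow> ('b \<Rightarrow> 'r \<Rightarrow> 'b)
    \<Rightarrow> ('g, 'f) ring_scheme \<Rightarrow> ('r \<Rightarrow> 'g \<Rightarrow> 'g) \<Rightarrow> ('a \<times> 'b \<times> 'g \<Rightarrow> int) set" where
  "tens3_rel R M1 r1 M2 l2 r2 M3 l3 =
     {fdiff (fdelta (x \<oplus>\<^bsub>M1\<^esub> x', y, z)) (fadd (fdelta (x, y, z)) (fdelta (x', y, z))) | x x' y z.
        x \<in> carrier M1 \<and> x' \<in> carrier M1 \<and> y \<in> carrier M2 \<and> z \<in> carrier M3}
   \<union> {fdiff (fdelta (x, y \<oplus>\<^bsub>M2\<^esub> y', z)) (fadd (fdelta (x, y, z)) (fdelta (x, y', z))) | x y y' z.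
        x \<in> carrier M1 \<and> y \<in> carrier M2 \<and> y' \<in> carrier M2 \<and> z \<in> carrier M3}
   \<union> {fdiff (fdelta (x, y, z \<oplus>\<^bsub>M3\<^esub> z')) (fadd (fdelta (x, y, z)) (fdelta (x, y, z'))) | x y z z'.
        x \<in> carrier M1 \<and> y \<in> carrier M2 \<and> z \<in> carrier M3 \<and> z' \<in> carrier M3}
   \<union> {fdiff (fdelta (r1 x r, y, z)) (fdelta (x, l2 r y, z)) | x r y z.
        x \<in> carrier M1 \<and> r \<in> carrier R \<and> y \<in> carrier M2 \<and> z \<in> carrier M3}
   \<union> {fdiff (fdelta (x, r2 y r, z)) (fdelta (x, y, l3 r z)) | x r y z.
        x \<in> carrier M1 \<and> r \<in> carrier R \<and> y \<in> carrier M2 \<and> z \<in> carrier M3}"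

definition tens3_eq :: "('r, 'c) ring_scheme \<Rightarrow> ('a, 'd) ring_scheme \<Rightarrow> ('a \<Rightarrow> 'r \<Rightarrow> 'a)
    \<Rightarrow> ('b, 'e) ring_scheme \<Rightarrow> ('r \<Rightarrow> 'b \<Rightarrow> 'b) \<Rightarrow> ('b \<Rightarrow> 'r \<Rightarrow> 'b)
    \<Rightarrow> ('g, 'f) ring_scheme \<Rightarrow> ('r \<Rightarrow> 'g \<Rightarrow> 'g)
    \<Rightarrow> ('a \<times> 'b \<times> 'g \<Rightarrow> int) \<Rightarrow> ('a \<times> 'b \<times> 'g \<Rightarrow> int) \<Rightarrow> bool" where
  "tens3_eq R M1 r1 M2 l2 r2 M3 l3 x y \<longleftrightarrow>
     x \<in> free_ab (carrier M1 \<times> carrier M2 \<times> carrier M3) \<and>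
     y \<in> free_ab (carrier M1 \<times> carrier M2 \<times> carrier M3) \<and>
     fdiff x y \<in> zspan (tens3_rel R M1 r1 M2 l2 r2 M3 l3)"

definition k_algebra :: "('k, 'c) ring_scheme \<Rightarrow> ('a, 'd) ring_scheme \<Rightarrow> ('k \<Rightarrow> 'a) \<Rightarrow> bool" where
  "k_algebra k A i \<longleftrightarrow> cring k \<and> ring A \<and> i \<in> ring_hom k A \<and>
     (\<forall>c\<in>carrier k. \<forall>a\<in>carrier A. i c \<otimes>\<^bsub>A\<^esub> a = a \<otimes>\<^bsub>A\<^esub> i c)"

text \<open>An A^e-algebra (A^e = A (x)_k A^op): a k-algebra U with a k-algebra map
  eta : A^e -> U; equivalently (universal property of A (x)_k A^op) a pair of
  k-algebra maps s = eta(- (x) 1) : A -> U and t = eta(1 (x) -) : A^op -> U with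
  commuting images; eta(a (x) b) = s a * t b.\<close>
definition Ae_algebra :: "('k, 'c) ring_scheme \<Rightarrow> ('a, 'd) ring_scheme \<Rightarrow> ('u, 'e) ring_scheme
    \<Rightarrow> ('k \<Rightarrow> 'a) \<Rightarrow> ('k \<Rightarrow> 'u) \<Rightarrow> ('a \<Rightarrow> 'u) \<Rightarrow> ('a \<Rightarrow> 'u) \<Rightarrow> bool" where
  "Ae_algebra k A U iA iU s t \<longleftrightarrow>
     k_algebra k A iA \<and> k_algebra k U iU \<and>
     s \<in> ring_hom A U \<and>
     t \<in> carrier A \<rightarrow> carrier U \<and>
     (\<forall>a\<in>carrier A. \<forall>b\<in>carrier A. t (a \<oplus>\<^bsub>A\<^esub> b) = t a \<oplus>\<^bsub>U\<^esub> t b) \<and>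
     (\<forall>a\<in>carrier A. \<forall>b\<in>carrier A. t (a \<otimes>\<^bsub>A\<^esub> b) = t b \<otimes>\<^bsub>U\<^esub> t a) \<and>
     t \<one>\<^bsub>A\<^esub> = \<one>\<^bsub>U\<^esub> \<and>
     (\<forall>a\<in>carrier A. \<forall>b\<in>carrier A. s a \<otimes>\<^bsub>U\<^esub> t b = t b \<otimes>\<^bsub>U\<^esub> s a) \<and>
     (\<forall>c\<in>carrier k. s (iA c) = iU c \<and> t (iA c) = iU c)"

text \<open>U (x)_A U: tensor product of U_\<lhd> (u \<lhd> a = t a * u) and \<rhd>U (a \<rhd> v = s a * v).\<close>
definition UU_eq :: "('a, 'd) ring_scheme \<Rightarrow> ('u, 'e) ring_scheme \<Rightarrow> ('a \<Rightarrow> 'u) \<Rightarrow> ('a \<Rightarrow> 'u)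
    \<Rightarrow> ('u \<times> 'u \<Rightarrow> int) \<Rightarrow> ('u \<times> 'u \<Rightarrow> int) \<Rightarrow> bool" where
  "UU_eq A U s t = tens_eq A U (\<lambda>u a. t a \<otimes>\<^bsub>U\<^esub> u) U (\<lambda>a v. s a \<otimes>\<^bsub>U\<^esub> v)"

definition UUU_eq :: "('a, 'd) ring_scheme \<Rightarrow> ('u, 'e) ring_scheme \<Rightarrow> ('a \<Rightarrow> 'u) \<Rightarrow> ('a \<Rightarrow> 'u)
    \<Rightarrow> ('u \<times> 'u \<times> 'u \<Rightarrow> int) \<Rightarrow> ('u \<times> 'u \<times> 'u \<Rightarrow> int) \<Rightarrow> bool" where
  "UUU_eq A U s t = tens3_eq A U (\<lambda>u a. t a \<otimes>\<^bsub>U\<^esub> u) U (\<lambda>a v. s a \<otimes>\<^bsub>U\<^esub> v)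
      (\<lambda>v a. t a \<otimes>\<^bsub>U\<^esub> v) U (\<lambda>a w. s a \<otimes>\<^bsub>U\<^esub> w)"

text \<open>\<blacktriangleright>U (x)_{A^op} U_\<lhd>: relation a \<blacktriangleright> u (x) v = u (x) v \<lhd> a, where a \<blacktriangleright> u = u * t a
  and v \<lhd> a = t a * v.\<close>
definition UopU_eq :: "('a, 'd) ring_scheme \<Rightarrow> ('u, 'e) ring_scheme \<Rightarrow> ('a \<Rightarrow> 'u)
    \<Rightarrow> ('u \<times> 'u \<Rightarrow> int) \<Rightarrow> ('u \<times> 'u \<Rightarrow> int) \<Rightarrow> bool" where
  "UopU_eq A U t = tens_eq A U (\<lambda>u a. u \<otimes>\<^bsub>U\<^esub> t a) U (\<lambda>a v. t a \<otimes>\<^bsub>U\<^esub> v)"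

definition tmul :: "('u, 'e) ring_scheme \<Rightarrow> ('u \<times> 'u \<Rightarrow> int) \<Rightarrow> ('u \<times> 'u \<Rightarrow> int) \<Rightarrow> 'u \<times> 'u \<Rightarrow> int" where
  "tmul U x y = free_lift (\<lambda>(a, b). free_lift (\<lambda>(c, d). fdelta (a \<otimes>\<^bsub>U\<^esub> c, b \<otimes>\<^bsub>U\<^esub> d)) y) x"

text \<open>The comultiplication \<Delta>-hat is given by a choice of representative delta u of
  \<Delta>(u) = u_(1) (x) u_(2) in U (x)_A U; epsh u is \<epsilon>-hat(u) in End_k(A), and
  \<epsilon>(u) = \<epsilon>-hat(u)(1).\<close>
definition times_bialgebra :: "('k, 'c) ring_scheme \<Rightarrow> ('a, 'd) ring_scheme \<Rightarrow> ('u, 'e) ring_scheme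
    \<Rightarrow> ('k \<Rightarrow> 'a) \<Rightarrow> ('k \<Rightarrow> 'u) \<Rightarrow> ('a \<Rightarrow> 'u) \<Rightarrow> ('a \<Rightarrow> 'u)
    \<Rightarrow> ('u \<Rightarrow> 'u \<times> 'u \<Rightarrow> int) \<Rightarrow> ('u \<Rightarrow> 'a \<Rightarrow> 'a) \<Rightarrow> bool" where
  "times_bialgebra k A U iA iU s t delta epsh \<longleftrightarrow>
     Ae_algebra k A U iA iU s t \<and>
     \<comment> \<open>\<Delta>-hat : U \<rightarrow> U \<times>_A U\<close>
     (\<forall>u\<in>carrier U. delta u \<in> free_ab (carrier U \<times> carrier U)) \<and>
     (\<forall>u\<in>carrier U. \<forall>a\<in>carrier A.
        UU_eq A U s t (fmap2 (\<lambda>x. x \<otimes>\<^bsub>U\<^esub> t a) id (delta u)) (fmap2 id (\<lambda>y. y \<otimes>\<^bsub>U\<^esub> s a) (delta u))) \<and>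
     \<comment> \<open>\<Delta>-hat is an A^e-algebra map\<close>
     (\<forall>u\<in>carrier U. \<forall>v\<in>carrier U. UU_eq A U s t (delta (u \<oplus>\<^bsub>U\<^esub> v)) (fadd (delta u) (delta v))) \<and>
     (\<forall>u\<in>carrier U. \<forall>v\<in>carrier U. UU_eq A U s t (delta (u \<otimes>\<^bsub>U\<^esub> v)) (tmul U (delta u) (delta v))) \<and>
     (\<forall>c\<in>carrier k. \<forall>u\<in>carrier U.
        UU_eq A U s t (delta (iU c \<otimes>\<^bsub>U\<^esub> u)) (fmap2 (\<lambda>x. iU c \<otimes>\<^bsub>U\<^esub> x) id (delta u))) \<and>
     UU_eq A U s t (delta \<one>\<^bsub>U\<^esub>) (fdelta (\<one>\<^bsub>U\<^esub>, \<one>\<^bsub>U\<^esub>)) \<and>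
     (\<forall>a\<in>carrier A. \<forall>b\<in>carrier A.
        UU_eq A U s t (delta (s a \<otimes>\<^bsub>U\<^esub> t b)) (fdelta (s a, t b))) \<and>
     \<comment> \<open>\<epsilon>-hat : U \<rightarrow> End_k(A) is an A^e-algebra map\<close>
     (\<forall>u\<in>carrier U. (\<forall>x\<in>carrier A. epsh u x \<in> carrier A) \<and>
        (\<forall>x\<in>carrier A. \<forall>y\<in>carrier A. epsh u (x \<oplus>\<^bsub>A\<^esub> y) = epsh u x \<oplus>\<^bsub>A\<^esub> epsh u y) \<and>
        (\<forall>c\<in>carrier k. \<forall>x\<in>carrier A. epsh u (iA c \<otimes>\<^bsub>A\<^esub> x) = iA c \<otimes>\<^bsub>A\<^esub> epsh u x)) \<and>
     (\<forall>u\<in>carrier U. \<forall>v\<in>carrier U. \<forall>x\<in>carrier A.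
        epsh (u \<oplus>\<^bsub>U\<^esub> v) x = epsh u x \<oplus>\<^bsub>A\<^esub> epsh v x) \<and>
     (\<forall>u\<in>carrier U. \<forall>v\<in>carrier U. \<forall>x\<in>carrier A.
        epsh (u \<otimes>\<^bsub>U\<^esub> v) x = epsh u (epsh v x)) \<and>
     (\<forall>c\<in>carrier k. \<forall>u\<in>carrier U. \<forall>x\<in>carrier A.
        epsh (iU c \<otimes>\<^bsub>U\<^esub> u) x = iA c \<otimes>\<^bsub>A\<^esub> epsh u x) \<and>
     (\<forall>x\<in>carrier A. epsh \<one>\<^bsub>U\<^esub> x = x) \<and>
     (\<forall>a\<in>carrier A. \<forall>b\<in>carrier A. \<forall>x\<in>carrier A.
        epsh (s a \<otimes>\<^bsub>U\<^esub> t b) x = a \<otimes>\<^bsub>A\<^esub> x \<otimes>\<^bsub>A\<^esub> b) \<and>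
     \<comment> \<open>\<Delta> and \<epsilon> are A-bimodule maps (a \<rhd> u \<lhd> b = s a * t b * u)\<close>
     (\<forall>a\<in>carrier A. \<forall>b\<in>carrier A. \<forall>u\<in>carrier U.
        UU_eq A U s t (delta (s a \<otimes>\<^bsub>U\<^esub> t b \<otimes>\<^bsub>U\<^esub> u))
          (fmap2 (\<lambda>x. s a \<otimes>\<^bsub>U\<^esub> x) (\<lambda>y. t b \<otimes>\<^bsub>U\<^esub> y) (delta u))) \<and>
     (\<forall>a\<in>carrier A. \<forall>b\<in>carrier A. \<forall>u\<in>carrier U.
        epsh (s a \<otimes>\<^bsub>U\<^esub> t b \<otimes>\<^bsub>U\<^esub> u) \<one>\<^bsub>A\<^esub> = a \<otimes>\<^bsub>A\<^esub> epsh u \<one>\<^bsub>A\<^esub> \<otimes>\<^bsub>A\<^esub> b) \<and>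
     \<comment> \<open>coassociativity: (\<Delta> (x) id) \<Delta> = (id (x) \<Delta>) \<Delta> in U (x)_A U (x)_A U\<close>
     (\<forall>u\<in>carrier U. UUU_eq A U s t
        (free_lift (\<lambda>(x, y). free_lift (\<lambda>(p, q). fdelta (p, q, y)) (delta x)) (delta u))
        (free_lift (\<lambda>(x, y). free_lift (\<lambda>(p, q). fdelta (x, p, q)) (delta y)) (delta u))) \<and>
     \<comment> \<open>counitality: \<epsilon>(u_(1)) \<rhd> u_(2) = u = u_(1) \<lhd> \<epsilon>(u_(2))\<close>
     (\<forall>u\<in>carrier U.
        feval U (\<lambda>(x, y). s (epsh x \<one>\<^bsub>A\<^esub>) \<otimes>\<^bsub>U\<^esub> y) (delta u) = u \<and>
        feval U (\<lambda>(x, y). t (epsh y \<one>\<^bsub>A\<^esub>) \<otimes>\<^bsub>U\<^esub> x) (delta u) = u)"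

text \<open>Galois map \<blacktriangleright>U (x)_{A^op} U_\<lhd> \<rightarrow> U_\<lhd> (x)_A \<rhd>U, u (x) v \<mapsto> u_(1) (x) u_(2) v,
  on representatives.\<close>
definition galois_rep :: "('u, 'e) ring_scheme \<Rightarrow> ('u \<Rightarrow> 'u \<times> 'u \<Rightarrow> int)
    \<Rightarrow> ('u \<times> 'u \<Rightarrow> int) \<Rightarrow> 'u \<times> 'u \<Rightarrow> int" where
  "galois_rep U delta =
     free_lift (\<lambda>(u, v). free_lift (\<lambda>(x, y). fdelta (x, y \<otimes>\<^bsub>U\<^esub> v)) (delta u))"

definition times_hopf :: "('k, 'c) ring_scheme \<Rightarrow> ('a, 'd) ring_scheme \<Rightarrow> ('u, 'e) ring_scheme
    \<Rightarrow> ('k \<Rightarrow> 'a) \<Rightarrow> ('k \<Rightarrow> 'u) \<Rightarrow> ('a \<Rightarrow> 'u) \<Rightarrow> ('a \<Rightarrow> 'u)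
    \<Rightarrow> ('u \<Rightarrow> 'u \<times> 'u \<Rightarrow> int) \<Rightarrow> ('u \<Rightarrow> 'a \<Rightarrow> 'a) \<Rightarrow> bool" where
  "times_hopf k A U iA iU s t delta epsh \<longleftrightarrow>
     times_bialgebra k A U iA iU s t delta epsh \<and>
     \<comment> \<open>the Galois map is injective on equivalence classes\<close>
     (\<forall>z\<in>free_ab (carrier U \<times> carrier U). \<forall>z'\<in>free_ab (carrier U \<times> carrier U).
        UU_eq A U s t (galois_rep U delta z) (galois_rep U delta z') \<longrightarrow> UopU_eq A U t z z') \<and>
     \<comment> \<open>the Galois map is surjective\<close>
     (\<forall>w\<in>free_ab (carrier U \<times> carrier U). \<exists>z\<in>free_ab (carrier U \<times> carrier U).
        UU_eq A U s t (galois_rep U delta z) w)"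

definition lmodule :: "('r, 'c) ring_scheme \<Rightarrow> ('r, 'm) module \<Rightarrow> bool" where
  "lmodule R M \<longleftrightarrow> ring R \<and> abelian_group M \<and>
     (\<forall>r\<in>carrier R. \<forall>m\<in>carrier M. r \<odot>\<^bsub>M\<^esub> m \<in> carrier M) \<and>
     (\<forall>r\<in>carrier R. \<forall>r'\<in>carrier R. \<forall>m\<in>carrier M.
        (r \<oplus>\<^bsub>R\<^esub> r') \<odot>\<^bsub>M\<^esub> m = r \<odot>\<^bsub>M\<^esub> m \<oplus>\<^bsub>M\<^esub> r' \<odot>\<^bsub>M\<^esub> m) \<and>
     (\<forall>r\<in>carrier R. \<forall>m\<in>carrier M. \<forall>m'\<in>carrier M.
        r \<odot>\<^bsub>M\<^esub> (m \<oplus>\<^bsub>M\<^esub> m') = r \<odot>\<^bsub>M\<^esub> m \<oplus>\<^bsub>M\<^esub> r \<odot>\<^bsub>M\<^esub> m') \<and>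
     (\<forall>r\<in>carrier R. \<forall>r'\<in>carrier R. \<forall>m\<in>carrier M.
        (r \<otimes>\<^bsub>R\<^esub> r') \<odot>\<^bsub>M\<^esub> m = r \<odot>\<^bsub>M\<^esub> (r' \<odot>\<^bsub>M\<^esub> m)) \<and>
     (\<forall>m\<in>carrier M. \<one>\<^bsub>R\<^esub> \<odot>\<^bsub>M\<^esub> m = m)"

text \<open>Right R-module; the field smult is read as r \<odot> m = m \<cdot> r.\<close>
definition rmodule :: "('r, 'c) ring_scheme \<Rightarrow> ('r, 'm) module \<Rightarrow> bool" where
  "rmodule R M \<longleftrightarrow> ring R \<and> abelian_group M \<and>
     (\<forall>r\<in>carrier R. \<forall>m\<in>carrier M. r \<odot>\<^bsub>M\<^esub> m \<in> carrier M) \<and>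
     (\<forall>r\<in>carrier R. \<forall>r'\<in>carrier R. \<forall>m\<in>carrier M.
        (r \<oplus>\<^bsub>R\<^esub> r') \<odot>\<^bsub>M\<^esub> m = r \<odot>\<^bsub>M\<^esub> m \<oplus>\<^bsub>M\<^esub> r' \<odot>\<^bsub>M\<^esub> m) \<and>
     (\<forall>r\<in>carrier R. \<forall>m\<in>carrier M. \<forall>m'\<in>carrier M.
        r \<odot>\<^bsub>M\<^esub> (m \<oplus>\<^bsub>M\<^esub> m') = r \<odot>\<^bsub>M\<^esub> m \<oplus>\<^bsub>M\<^esub> r \<odot>\<^bsub>M\<^esub> m') \<and>
     (\<forall>r\<in>carrier R. \<forall>r'\<in>carrier R. \<forall>m\<in>carrier M.
        (r \<otimes>\<^bsub>R\<^esub> r') \<odot>\<^bsub>M\<^esub> m = r' \<odot>\<^bsub>M\<^esub> (r \<odot>\<^bsub>M\<^esub> m)) \<and>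
     (\<forall>m\<in>carrier M. \<one>\<^bsub>R\<^esub> \<odot>\<^bsub>M\<^esub> m = m)"

text \<open>Module homomorphisms (same formula for left and right modules).\<close>
definition mod_hom :: "('r, 'c) ring_scheme \<Rightarrow> ('r, 'm) module \<Rightarrow> ('r, 'n) module \<Rightarrow> ('m \<Rightarrow> 'n) \<Rightarrow> bool" where
  "mod_hom R M N h \<longleftrightarrow> h \<in> carrier M \<rightarrow> carrier N \<and>
     (\<forall>m\<in>carrier M. \<forall>m'\<in>carrier M. h (m \<oplus>\<^bsub>M\<^esub> m') = h m \<oplus>\<^bsub>N\<^esub> h m') \<and>
     (\<forall>r\<in>carrier R. \<forall>m\<in>carrier M. h (r \<odot>\<^bsub>M\<^esub> m) = r \<odot>\<^bsub>N\<^esub> h m)"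

definition free_lmod :: "('r, 'c) ring_scheme \<Rightarrow> 'i set \<Rightarrow> ('r, 'i \<Rightarrow> 'r) module" where
  "free_lmod R I = \<lparr>carrier = {f. (\<forall>i\<in>I. f i \<in> carrier R) \<and> (\<forall>i. i \<notin> I \<longrightarrow> f i = \<zero>\<^bsub>R\<^esub>) \<and>
                                   finite {i. f i \<noteq> \<zero>\<^bsub>R\<^esub>}},
      mult = undefined, one = undefined, zero = (\<lambda>i. \<zero>\<^bsub>R\<^esub>),
      add = (\<lambda>f g i. f i \<oplus>\<^bsub>R\<^esub> g i), smult = (\<lambda>r f i. r \<otimes>\<^bsub>R\<^esub> f i)\<rparr>"

definition free_rmod :: "('r, 'c) ring_scheme \<Rightarrow> 'i set \<Rightarrow> ('r, 'i \<Rightarrow> 'r) module" where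
  "free_rmod R I = \<lparr>carrier = {f. (\<forall>i\<in>I. f i \<in> carrier R) \<and> (\<forall>i. i \<notin> I \<longrightarrow> f i = \<zero>\<^bsub>R\<^esub>) \<and>
                                   finite {i. f i \<noteq> \<zero>\<^bsub>R\<^esub>}},
      mult = undefined, one = undefined, zero = (\<lambda>i. \<zero>\<^bsub>R\<^esub>),
      add = (\<lambda>f g i. f i \<oplus>\<^bsub>R\<^esub> g i), smult = (\<lambda>r f i. f i \<otimes>\<^bsub>R\<^esub> r)\<rparr>"

text \<open>Projective module = direct summand of a free module. (The index set is taken
  inside the element type of M; no loss of generality, since a projective M is a
  summand of the free module on the set carrier M.)\<close>
definition lprojective :: "('r, 'c) ring_scheme \<Rightarrow> ('r, 'm) module \<Rightarrow> bool" where
  "lprojective R M \<longleftrightarrow> lmodule R M \<and>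
     (\<exists>(I :: 'm set) i p. mod_hom R M (free_lmod R I) i \<and> mod_hom R (free_lmod R I) M p \<and>
        (\<forall>m\<in>carrier M. p (i m) = m))"

definition rprojective :: "('r, 'c) ring_scheme \<Rightarrow> ('r, 'm) module \<Rightarrow> bool" where
  "rprojective R M \<longleftrightarrow> rmodule R M \<and>
     (\<exists>(I :: 'm set) i p. mod_hom R M (free_rmod R I) i \<and> mod_hom R (free_rmod R I) M p \<and>
        (\<forall>m\<in>carrier M. p (i m) = m))"

text \<open>U_\<lhd> as right A-module: u \<lhd> a = \<eta>(1 (x) a) u = t a * u.\<close>
definition U_rtri :: "('a, 'd) ring_scheme \<Rightarrow> 'u ring \<Rightarrow> ('a \<Rightarrow> 'u) \<Rightarrow> ('a, 'u) module" where
  "U_rtri A U t = \<lparr>carrier = carrier U, mult = mult U, one = one U, zero = zero U,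
      add = add U, smult = (\<lambda>a u. t a \<otimes>\<^bsub>U\<^esub> u)\<rparr>"

text \<open>The left U-module P (x) Q = P_\<lhd> (x)_A \<rhd>Q with u(p (x) q) = u_(1) p (x) u_(2) q,
  realised as the quotient of the free abelian group on carrier P x carrier Q.\<close>
definition tensor_mod :: "('a, 'd) ring_scheme \<Rightarrow> ('a \<Rightarrow> 'u) \<Rightarrow> ('a \<Rightarrow> 'u)
    \<Rightarrow> ('u \<Rightarrow> 'u \<times> 'u \<Rightarrow> int) \<Rightarrow> ('u, 'p) module \<Rightarrow> ('u, 'q) module
    \<Rightarrow> ('u, ('p \<times> 'q \<Rightarrow> int) set) module" where
  "tensor_mod A s t delta P Q =
    (let eq = tens_eq A P (\<lambda>p a. t a \<odot>\<^bsub>P\<^esub> p) Q (\<lambda>a q. s a \<odot>\<^bsub>Q\<^esub> q);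
         cls = (\<lambda>x. {y. eq x y});
         rep = (\<lambda>X. SOME x. x \<in> X)
     in \<lparr>carrier = cls ` free_ab (carrier P \<times> carrier Q),
         mult = undefined, one = undefined,
         zero = cls fzero,
         add = (\<lambda>X Y. cls (fadd (rep X) (rep Y))),
         smult = (\<lambda>u X. cls (free_lift (\<lambda>(p, q).
                     free_lift (\<lambda>(a, b). fdelta (a \<odot>\<^bsub>P\<^esub> p, b \<odot>\<^bsub>Q\<^esub> q)) (delta u)) (rep X)))\<rparr>)"

end

theory Submission
  imports Defs
begin

text \<open>
  Choose dual bases \<open>(x\<^sub>i, f\<^sub>i)\<close> of \<open>P\<close> and \<open>(y\<^sub>j, g\<^sub>j)\<close> of \<open>Q\<close> over \<open>U\<close>, and a dual basis
  \<open>(e\<^sub>k, \<phi>\<^sub>k)\<close> of the right \<open>A\<close>-module \<open>U\<^sub>\<lhd>\<close>. The maps \<open>f\<^sub>i \<otimes> g\<^sub>j : P \<otimes> Q \<rightarrow> U \<otimes> U\<close> and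
  \<open>x \<otimes> y \<mapsto> x x\<^sub>i \<otimes> y y\<^sub>j\<close> are \<open>U\<close>-linear, so it suffices to treat \<open>U \<otimes> U\<close>. The Galois map \<open>\<beta>\<close>
  carries left multiplication on the first factor to the diagonal action, and
  \<open>\<Phi>\<^sub>k (u \<otimes> v) = u t(\<phi>\<^sub>k v)\<close> is well defined on its source. Hence \<open>\<Phi>\<^sub>k \<circ> \<beta>\<^sup>-\<^sup>1\<close> is \<open>U\<close>-linear, and
  together with the elements \<open>1 \<otimes> e\<^sub>k\<close> these functionals form a dual basis of \<open>U \<otimes> U\<close>, because
  \<open>t(a) (1 \<otimes> v) = 1 \<otimes> t(a) v\<close>.
\<close>

section \<open>Free abelian groups\<close>

text \<open>The source of \<beta> is the better side because there \<open>U\<close> acts on the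
  first factor alone. If \<open>U\<^sub>\<lhd>\<close> is a summand of a direct sum of copies of
  \<open>A\<close>, then the source is a summand of a direct sum of copies of
  \<open>U \<otimes> A\<close>, that is, of \<open>U\<close> under left multiplication. In these
  terms \<open>\<Phi>\<^sub>k\<close> is \<open>id \<otimes> \<phi>\<^sub>k\<close>. The Hopf
  condition carries the splitting over to the diagonal structure, where it is not visible directly.

  Two features of the encoding shape the argument. Tensor products are quotients of formal integer
  sums and \<open>delta\<close> merely chooses representatives, so the laws of the diagonal action
  hold only modulo the relations. Moreover, \<open>lprojective\<close> demands an index set inside
  the element type of the module, whereas the dual basis found here is indexed by triples
  \<open>(i, j, k)\<close>. Splittings are therefore treated as families of maps over arbitrary
  index sets and are reindexed by the basis elements themselves at the end.\<close>

lemma free_ab_fzero [simp]: "fzero \<in> free_ab S"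
  by (simp add: free_ab_def fzero_def fsupp_def)

lemma fsupp_fdelta [simp]: "fsupp (fdelta x) = {x}"
  by (auto simp: fsupp_def fdelta_def)

lemma free_ab_fdelta [simp]: "fdelta x \<in> free_ab S \<longleftrightarrow> x \<in> S"
  by (simp add: free_ab_def)

lemma fsupp_fadd: "fsupp (fadd f g) \<subseteq> fsupp f \<union> fsupp g"
  by (auto simp: fsupp_def fadd_def)

lemma fsupp_fdiff: "fsupp (fdiff f g) \<subseteq> fsupp f \<union> fsupp g"
  by (auto simp: fsupp_def fdiff_def)

lemma free_ab_fadd [simp]: "f \<in> free_ab S \<Longrightarrow> g \<in> free_ab S \<Longrightarrow> fadd f g \<in> free_ab S"
  using fsupp_fadd[of f g] by (auto simp: free_ab_def intro: finite_subset)

lemma free_ab_fdiff [simp]: "f \<in> free_ab S \<Longrightarrow> g \<in> free_ab S \<Longrightarrow> fdiff f g \<in> free_ab S"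
  using fsupp_fdiff[of f g] by (auto simp: free_ab_def intro: finite_subset)

text \<open>\<open>zspan\<close> is built from differences alone; with this rewriting, each closure
  property for differences yields the one for sums.\<close>

lemma fadd_eq_fdiff: "fadd f g = fdiff f (fdiff fzero g)"
  by (simp add: fadd_def fdiff_def fzero_def)

lemma fdiff_self [simp]: "fdiff f f = fzero"
  by (simp add: fdiff_def fzero_def)

lemma fdiff_fzero [simp]: "fdiff f fzero = f"
  by (simp add: fdiff_def fzero_def)

lemma fadd_fdiff_cancel [simp]: "fadd (fdiff f g) g = f"
  by (simp add: fdiff_def fadd_def)

lemma fadd_assoc: "fadd (fadd f g) h = fadd f (fadd g h)"
  by (simp add: fadd_def fun_eq_iff)

lemma fadd_commute: "fadd f g = fadd g f"
  by (simp add: fadd_def fun_eq_iff)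

lemma fadd_fzero [simp]: "fadd fzero f = f"
  by (simp add: fadd_def fzero_def)

lemma zspan_fadd: "f \<in> zspan G \<Longrightarrow> g \<in> zspan G \<Longrightarrow> fadd f g \<in> zspan G"
  unfolding fadd_eq_fdiff by (intro zspan_diff zspan_zero)

lemma zspan_smult: "f \<in> zspan G \<Longrightarrow> (\<lambda>x. n * f x) \<in> zspan G"
proof (induction n rule: int_induct[where k = 0])
  case base
  then show ?case using zspan_zero[of G] by (simp add: fzero_def)
next
  case (step1 i)
  have "(\<lambda>x. (i + 1) * f x) = fadd (\<lambda>x. i * f x) f"
    by (simp add: fadd_def algebra_simps)
  with step1 show ?case by (simp add: zspan_fadd)
next
  case (step2 i)
  have "(\<lambda>x. (i - 1) * f x) = fdiff (\<lambda>x. i * f x) f"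
    by (simp add: fdiff_def algebra_simps)
  with step2 show ?case by (simp add: zspan_diff)
qed

lemma free_ab_subset_zspan: "free_ab S \<subseteq> zspan (fdelta ` S)"
proof -
  \<comment> \<open>The finite set is only required to contain the support, so that erasing the
    value at one point leads back to the induction hypothesis.\<close>
  have "finite F \<Longrightarrow> F \<subseteq> S \<Longrightarrow> fsupp f \<subseteq> F \<Longrightarrow> f \<in> zspan (fdelta ` S)" for F f
  proof (induction F arbitrary: f rule: finite_induct)
    case empty
    then have "f = fzero" by (auto simp: fsupp_def fzero_def)
    then show ?case by (simp add: zspan_zero)
  next
    case (insert a F)
    have "f = fadd (f(a := 0)) (\<lambda>x. f a * fdelta a x)"
      by (auto simp: fadd_def fdelta_def)
    moreover have "f(a := 0) \<in> zspan (fdelta ` S)"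
      using insert.prems by (intro insert.IH) (auto simp: fsupp_def)
    moreover have "(\<lambda>x. f a * fdelta a x) \<in> zspan (fdelta ` S)"
      using insert.prems by (intro zspan_smult zspan_gen) auto
    ultimately show ?case by (metis zspan_fadd)
  qed
  then show ?thesis by (auto simp: free_ab_def)
qed

text \<open>Zero, the generators and differences exhaust the free abelian group, so negatives and
  sums need no separate cases. Identities between linear extensions, and later the splitting of
  tensor products, are reduced to generators in this way.\<close>

lemma free_ab_induct [consumes 1, case_names zero delta diff]:
  assumes "f \<in> free_ab S" and "P fzero" and "\<And>x. x \<in> S \<Longrightarrow> P (fdelta x)"
    and diff: "\<And>f g. f \<in> free_ab S \<Longrightarrow> g \<in> free_ab S \<Longrightarrow> P f \<Longrightarrow> P g \<Longrightarrow> P (fdiff f g)"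
  shows "P f"
proof -
  have "f \<in> zspan (fdelta ` S)" using assms(1) free_ab_subset_zspan by blast
  then have "f \<in> free_ab S \<and> P f"
    by induction (use assms in auto)
  then show ?thesis ..
qed

section \<open>Linear extension from generators to formal sums\<close>

lemma free_lift_superset:
  assumes "finite T" "fsupp f \<subseteq> T"
  shows "free_lift g f = (\<lambda>y. \<Sum>x\<in>T. f x * g x y)"
  unfolding free_lift_def
  by (rule ext, rule sum.mono_neutral_left) (use assms in \<open>auto simp: fsupp_def\<close>)

lemma free_lift_fzero [simp]: "free_lift g fzero = fzero"
  by (simp add: free_lift_def fsupp_def fzero_def)

lemma free_lift_fdelta [simp]: "free_lift g (fdelta x) = g x"
  by (simp add: free_lift_def) (simp add: fdelta_def)

lemma free_lift_fdiff':
  assumes "finite (fsupp x)" "finite (fsupp y)"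
  shows "free_lift g (fdiff x y) = fdiff (free_lift g x) (free_lift g y)"
proof -
  \<comment> \<open>The supports of \<open>x\<close>, \<open>y\<close> and their difference may all
    differ, so the three sums are first written over one common finite set.\<close>
  let ?T = "fsupp x \<union> fsupp y"
  have "free_lift g z = (\<lambda>w. \<Sum>v\<in>?T. z v * g v w)" if "fsupp z \<subseteq> ?T" for z
    using assms that by (intro free_lift_superset) auto
  then show ?thesis using fsupp_fdiff[of x y]
    by (auto simp: fdiff_def left_diff_distrib sum_subtractf)
qed

lemma free_lift_fdiff:
  "x \<in> free_ab S \<Longrightarrow> y \<in> free_ab S \<Longrightarrow>
    free_lift g (fdiff x y) = fdiff (free_lift g x) (free_lift g y)"
  by (rule free_lift_fdiff') (auto simp: free_ab_def)

lemma free_lift_fadd: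
  "x \<in> free_ab S \<Longrightarrow> y \<in> free_ab S \<Longrightarrow>
    free_lift g (fadd x y) = fadd (free_lift g x) (free_lift g y)"
  unfolding fadd_eq_fdiff by (simp add: free_lift_fdiff[where S = S])

lemma free_lift_closed:
  assumes "x \<in> free_ab S" "\<And>s. s \<in> S \<Longrightarrow> g s \<in> free_ab T"
  shows "free_lift g x \<in> free_ab T"
  using assms(1) by (induction rule: free_ab_induct) (auto simp: assms(2) free_lift_fdiff[where S = S])

lemma free_lift_cong:
  assumes "x \<in> free_ab S" "\<And>s. s \<in> S \<Longrightarrow> g s = h s"
  shows "free_lift g x = free_lift h x"
  using assms(1) by (induction rule: free_ab_induct) (auto simp: assms(2) free_lift_fdiff[where S = S])

text \<open>Associativity of the monad of formal sums, with \<open>free_lift\<close> as its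
  extension operator and \<open>fdelta\<close> as its unit.\<close>

lemma free_lift_free_lift:
  assumes "x \<in> free_ab S" "\<And>s. s \<in> S \<Longrightarrow> g s \<in> free_ab T"
  shows "free_lift h (free_lift g x) = free_lift (\<lambda>s. free_lift h (g s)) x"
  using assms(1)
  by (induction rule: free_ab_induct)
     (auto simp: free_lift_fdiff[where S = S] free_lift_fdiff[where S = T]
        free_lift_closed[where T = T] assms(2))

lemma free_lift_diff_fun:
  "free_lift (\<lambda>s. fdiff (g s) (h s)) x = fdiff (free_lift g x) (free_lift h x)"
  by (simp add: free_lift_def fdiff_def right_diff_distrib sum_subtractf)

lemma free_lift_add_fun:
  "free_lift (\<lambda>s. fadd (g s) (h s)) x = fadd (free_lift g x) (free_lift h x)"
  by (simp add: free_lift_def fadd_def distrib_left sum.distrib)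

lemma free_lift_zero_fun: "free_lift (\<lambda>s. fzero) x = fzero"
  by (simp add: free_lift_def fzero_def)

lemma free_lift_swap:
  assumes "x \<in> free_ab S" "y \<in> free_ab T"
  shows "free_lift (\<lambda>a. free_lift (\<lambda>b. g a b) y) x = free_lift (\<lambda>b. free_lift (\<lambda>a. g a b) x) y"
  using assms(1)
  by (induction rule: free_ab_induct) (auto simp: free_lift_fdiff[where S = S] free_lift_diff_fun free_lift_zero_fun)

section \<open>Functoriality of formal sums of pairs\<close>

lemma fmap2_closed:
  assumes "x \<in> free_ab (S \<times> T)" "\<And>a. a \<in> S \<Longrightarrow> f a \<in> S'" "\<And>b. b \<in> T \<Longrightarrow> g b \<in> T'"
  shows "fmap2 f g x \<in> free_ab (S' \<times> T')"
  unfolding fmap2_def by (rule free_lift_closed[OF assms(1)]) (use assms in auto)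

lemma fmap2_cong:
  assumes "x \<in> free_ab (S \<times> T)" "\<And>a. a \<in> S \<Longrightarrow> f a = f' a" "\<And>b. b \<in> T \<Longrightarrow> g b = g' b"
  shows "fmap2 f g x = fmap2 f' g' x"
  unfolding fmap2_def by (rule free_lift_cong[OF assms(1)]) (use assms in auto)

lemma fmap2_fdelta [simp]: "fmap2 f g (fdelta (a, b)) = fdelta (f a, g b)"
  by (simp add: fmap2_def)

lemma fmap2_fzero [simp]: "fmap2 f g fzero = fzero"
  by (simp add: fmap2_def)

lemma fmap2_fadd:
  "x \<in> free_ab S \<Longrightarrow> y \<in> free_ab S \<Longrightarrow> fmap2 f g (fadd x y) = fadd (fmap2 f g x) (fmap2 f g y)"
  unfolding fmap2_def by (rule free_lift_fadd)

lemma fmap2_fdiff: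
  "x \<in> free_ab S \<Longrightarrow> y \<in> free_ab S \<Longrightarrow> fmap2 f g (fdiff x y) = fdiff (fmap2 f g x) (fmap2 f g y)"
  unfolding fmap2_def by (rule free_lift_fdiff)

lemma free_lift_fmap2:
  assumes "x \<in> free_ab S"
  shows "free_lift h (fmap2 f g x) = free_lift (\<lambda>(a, b). h (f a, g b)) x"
  unfolding fmap2_def
  by (subst free_lift_free_lift[OF assms, where T = UNIV])
     (auto simp: split_def)

lemma fmap2_fmap2:
  assumes "x \<in> free_ab S"
  shows "fmap2 f' g' (fmap2 f g x) = fmap2 (\<lambda>a. f' (f a)) (\<lambda>b. g' (g b)) x"
  by (simp add: fmap2_def[of f' g'] free_lift_fmap2[OF assms])
     (simp add: fmap2_def)

lemma fmap2_free_lift: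
  assumes "x \<in> free_ab S" "\<And>a. a \<in> S \<Longrightarrow> h a \<in> free_ab T"
  shows "fmap2 f g (free_lift h x) = free_lift (\<lambda>a. fmap2 f g (h a)) x"
  unfolding fmap2_def by (rule free_lift_free_lift[OF assms])

section \<open>Evaluation of formal sums in an abelian group\<close>

context abelian_group
begin

lemma feval_superset:
  assumes "finite T" "fsupp f \<subseteq> T" "T \<subseteq> S" "g \<in> S \<rightarrow> carrier G"
  shows "feval G g f = (\<Oplus>x\<in>T. [f x] \<cdot> g x)"
  unfolding feval_def
  by (rule add.finprod_mono_neutral_cong_left)
     (use assms in \<open>auto simp: fsupp_def Pi_iff subset_iff add_pow_def[of G 0] intro!: add.int_pow_closed\<close>)

lemma feval_closed [simp]:
  "f \<in> free_ab S \<Longrightarrow> g \<in> S \<rightarrow> carrier G \<Longrightarrow> feval G g f \<in> carrier G"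
  unfolding feval_def
  by (rule finsum_closed) (auto simp: free_ab_def intro!: add.int_pow_closed)

lemma feval_fzero [simp]: "feval G g fzero = \<zero>"
  by (simp add: feval_def fsupp_def fzero_def)

lemma feval_fdelta [simp]: "g x \<in> carrier G \<Longrightarrow> feval G g (fdelta x) = g x"
  unfolding feval_def fsupp_fdelta
  by (subst finsum_insert) (auto simp: fdelta_def)

lemma feval_fadd:
  assumes "x \<in> free_ab S" "y \<in> free_ab S" "g \<in> S \<rightarrow> carrier G"
  shows "feval G g (fadd x y) = feval G g x \<oplus> feval G g y"
proof -
  let ?T = "fsupp x \<union> fsupp y"
  have T: "finite ?T" "?T \<subseteq> S" using assms by (auto simp: free_ab_def)
  have *: "feval G g z = (\<Oplus>v\<in>?T. [z v] \<cdot> g v)" if "fsupp z \<subseteq> ?T" for z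
    by (rule feval_superset[where S = S]) (use T assms that in auto)
  have "feval G g (fadd x y) = (\<Oplus>v\<in>?T. [x v] \<cdot> g v \<oplus> [y v] \<cdot> g v)"
    unfolding *[OF fsupp_fadd]
    by (rule finsum_cong') (use T assms in \<open>auto simp: fadd_def add.int_pow_mult Pi_iff subset_iff\<close>)
  also have "\<dots> = feval G g x \<oplus> feval G g y"
    using T assms
    by (subst finsum_addf) (auto simp: *  Pi_iff subset_iff)
  finally show ?thesis .
qed

lemma feval_fdiff:
  assumes "x \<in> free_ab S" "y \<in> free_ab S" "g \<in> S \<rightarrow> carrier G"
  shows "feval G g (fdiff x y) = feval G g x \<ominus> feval G g y"
proof -
  have "feval G g x = feval G g (fdiff x y) \<oplus> feval G g y"
    using feval_fadd[of "fdiff x y" S y g] assms by simp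
  moreover have "feval G g x \<in> carrier G" "feval G g (fdiff x y) \<in> carrier G"
    "feval G g y \<in> carrier G"
    using assms by (auto intro!: feval_closed[where S = S])
  ultimately show ?thesis
    by (simp add: a_minus_def a_assoc r_neg)
qed

end

section \<open>Balanced tensor products\<close>

lemma tens_eqI:
  "x \<in> free_ab (carrier M \<times> carrier N) \<Longrightarrow> y \<in> free_ab (carrier M \<times> carrier N) \<Longrightarrow>
   fdiff x y \<in> zspan (tens_rel R M rm N ln) \<Longrightarrow> tens_eq R M rm N ln x y"
  by (simp add: tens_eq_def)

lemma tens_eq_carrier:
  assumes "tens_eq R M rm N ln x y"
  shows "x \<in> free_ab (carrier M \<times> carrier N)" "y \<in> free_ab (carrier M \<times> carrier N)"
  using assms by (auto simp: tens_eq_def)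

lemma tens_eq_refl: "x \<in> free_ab (carrier M \<times> carrier N) \<Longrightarrow> tens_eq R M rm N ln x x"
  by (simp add: tens_eq_def zspan_zero)

lemma tens_eq_sym: "tens_eq R M rm N ln x y \<Longrightarrow> tens_eq R M rm N ln y x"
proof -
  have "fdiff y x = fdiff fzero (fdiff x y)" by (simp add: fdiff_def fzero_def)
  then show "tens_eq R M rm N ln x y \<Longrightarrow> tens_eq R M rm N ln y x"
    by (auto simp: tens_eq_def intro: zspan_diff zspan_zero)
qed

lemma tens_eq_trans [trans]:
  "tens_eq R M rm N ln x y \<Longrightarrow> tens_eq R M rm N ln y z \<Longrightarrow> tens_eq R M rm N ln x z"
proof -
  have "fdiff x z = fadd (fdiff x y) (fdiff y z)" by (simp add: fdiff_def fadd_def)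
  then show "tens_eq R M rm N ln x y \<Longrightarrow> tens_eq R M rm N ln y z \<Longrightarrow> tens_eq R M rm N ln x z"
    by (auto simp: tens_eq_def intro: zspan_fadd)
qed

lemma tens_eq_fdiff:
  assumes "tens_eq R M rm N ln x x'" "tens_eq R M rm N ln y y'"
  shows "tens_eq R M rm N ln (fdiff x y) (fdiff x' y')"
proof -
  have "fdiff (fdiff x y) (fdiff x' y') = fdiff (fdiff x x') (fdiff y y')"
    by (auto simp: fdiff_def)
  then show ?thesis using assms by (auto simp: tens_eq_def intro: zspan_diff)
qed

lemma tens_eq_fadd:
  assumes "tens_eq R M rm N ln x x'" "tens_eq R M rm N ln y y'"
  shows "tens_eq R M rm N ln (fadd x y) (fadd x' y')"
  unfolding fadd_eq_fdiff by (intro tens_eq_fdiff tens_eq_refl assms) simp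

lemma tens_eq_add_left:
  assumes "abelian_group M" "m \<in> carrier M" "m' \<in> carrier M" "n \<in> carrier N"
  shows "tens_eq R M rm N ln (fdelta (m \<oplus>\<^bsub>M\<^esub> m', n)) (fadd (fdelta (m, n)) (fdelta (m', n)))"
  using assms abelian_groupE(1)[OF assms(1)]
  by (auto intro!: tens_eqI zspan_gen simp: tens_rel_def)

lemma tens_eq_add_right:
  assumes "abelian_group N" "m \<in> carrier M" "n \<in> carrier N" "n' \<in> carrier N"
  shows "tens_eq R M rm N ln (fdelta (m, n \<oplus>\<^bsub>N\<^esub> n')) (fadd (fdelta (m, n)) (fdelta (m, n')))"
  using assms abelian_groupE(1)[OF assms(1)]
  by (intro tens_eqI zspan_gen) (simp_all add: tens_rel_def, blast)

lemma tens_eq_balance: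
  assumes "m \<in> carrier M" "r \<in> carrier R" "n \<in> carrier N" "rm m r \<in> carrier M" "ln r n \<in> carrier N"
  shows "tens_eq R M rm N ln (fdelta (rm m r, n)) (fdelta (m, ln r n))"
  using assms by (auto intro!: tens_eqI zspan_gen simp: tens_rel_def)

text \<open>\<open>free_lift\<close> sums over the support and hence respects differences only for
  finitely supported functions; the finiteness has to accompany the induction.\<close>

lemma zspan_induct_diff [consumes 1, case_names fin zero gen diff]:
  assumes "x \<in> zspan G" "\<And>g. g \<in> G \<Longrightarrow> finite (fsupp g)" "P fzero" "\<And>g. g \<in> G \<Longrightarrow> P g"
    "\<And>f g. finite (fsupp f) \<Longrightarrow> finite (fsupp g) \<Longrightarrow> P f \<Longrightarrow> P g \<Longrightarrow> P (fdiff f g)"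
  shows "P x"
proof -
  from assms(1) have "finite (fsupp x) \<and> P x"
  proof induction
    case (zspan_diff f g)
    then show ?case using assms(5) fsupp_fdiff[of f g] by (meson finite_UnI finite_subset)
  qed (use assms in \<open>auto simp: fsupp_def fzero_def\<close>)
  then show ?thesis ..
qed

text \<open>Universal property of the tensor product when the target is again a tensor product given
  by formal sums. Additivity and balancing of \<open>g\<close> are therefore required only modulo
  the relations of the target.\<close>

lemma tens_eq_free_lift:
  assumes eq: "tens_eq R M rm N ln x y"
    and closed: "\<And>m n. m \<in> carrier M \<Longrightarrow> n \<in> carrier N \<Longrightarrow> g (m, n) \<in> free_ab (carrier M' \<times> carrier N')"
    and left: "\<And>m m' n. m \<in> carrier M \<Longrightarrow> m' \<in> carrier M \<Longrightarrow> n \<in> carrier N \<Longrightarrow>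
      tens_eq R' M' rm' N' ln' (g (m \<oplus>\<^bsub>M\<^esub> m', n)) (fadd (g (m, n)) (g (m', n)))"
    and right: "\<And>m n n'. m \<in> carrier M \<Longrightarrow> n \<in> carrier N \<Longrightarrow> n' \<in> carrier N \<Longrightarrow>
      tens_eq R' M' rm' N' ln' (g (m, n \<oplus>\<^bsub>N\<^esub> n')) (fadd (g (m, n)) (g (m, n')))"
    and bal: "\<And>m r n. m \<in> carrier M \<Longrightarrow> r \<in> carrier R \<Longrightarrow> n \<in> carrier N \<Longrightarrow>
      tens_eq R' M' rm' N' ln' (g (rm m r, n)) (g (m, ln r n))"
  shows "tens_eq R' M' rm' N' ln' (free_lift g x) (free_lift g y)"
proof -
  have xy: "x \<in> free_ab (carrier M \<times> carrier N)" "y \<in> free_ab (carrier M \<times> carrier N)"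
    using tens_eq_carrier[OF eq] by auto
  have d: "fdelta z \<in> free_ab UNIV" for z :: "'c \<times> 'e" by simp
  have "fdiff x y \<in> zspan (tens_rel R M rm N ln)" using eq by (simp add: tens_eq_def)
  then have "free_lift g (fdiff x y) \<in> zspan (tens_rel R' M' rm' N' ln')"
  proof (induction rule: zspan_induct_diff)
    case (fin z)
    then have "z \<in> free_ab UNIV" by (auto simp: tens_rel_def)
    then show ?case by (simp add: free_ab_def)
  next
    case (gen z)
    then show ?case using left right bal
      by (auto simp: tens_rel_def free_lift_fdiff[where S = UNIV] free_lift_fadd[where S = UNIV] tens_eq_def)
  qed (auto simp: zspan_zero free_lift_fdiff' intro: zspan_diff)
  moreover have "free_lift g z \<in> free_ab (carrier M' \<times> carrier N')"
    if "z \<in> free_ab (carrier M \<times> carrier N)" for z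
    by (rule free_lift_closed[OF that]) (use closed in auto)
  ultimately show ?thesis using xy
    by (auto intro!: tens_eqI simp: free_lift_fdiff)
qed

text \<open>Universal property with values in a genuine abelian group, so that the conditions on
  \<open>g\<close> are equations. It is what makes the functionals on the source of the Galois map
  well defined.\<close>

lemma tens_eq_feval:
  assumes eq: "tens_eq R M rm N ln x y" and B: "abelian_group B"
    and closed: "\<And>m n. m \<in> carrier M \<Longrightarrow> n \<in> carrier N \<Longrightarrow> g (m, n) \<in> carrier B"
    and M: "abelian_group M" and N: "abelian_group N"
    and rm: "\<And>m r. m \<in> carrier M \<Longrightarrow> r \<in> carrier R \<Longrightarrow> rm m r \<in> carrier M"
    and ln: "\<And>r n. r \<in> carrier R \<Longrightarrow> n \<in> carrier N \<Longrightarrow> ln r n \<in> carrier N"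
    and left: "\<And>m m' n. m \<in> carrier M \<Longrightarrow> m' \<in> carrier M \<Longrightarrow> n \<in> carrier N \<Longrightarrow>
      g (m \<oplus>\<^bsub>M\<^esub> m', n) = g (m, n) \<oplus>\<^bsub>B\<^esub> g (m', n)"
    and right: "\<And>m n n'. m \<in> carrier M \<Longrightarrow> n \<in> carrier N \<Longrightarrow> n' \<in> carrier N \<Longrightarrow>
      g (m, n \<oplus>\<^bsub>N\<^esub> n') = g (m, n) \<oplus>\<^bsub>B\<^esub> g (m, n')"
    and bal: "\<And>m r n. m \<in> carrier M \<Longrightarrow> r \<in> carrier R \<Longrightarrow> n \<in> carrier N \<Longrightarrow>
      g (rm m r, n) = g (m, ln r n)"
  shows "feval B g x = feval B g y"
proof -
  interpret B: abelian_group B by fact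
  interpret M: abelian_group M by fact
  interpret N: abelian_group N by fact
  let ?S = "carrier M \<times> carrier N"
  have g: "g \<in> ?S \<rightarrow> carrier B" using closed by auto
  note ev = B.feval_fdiff[OF _ _ g] B.feval_fadd[OF _ _ g] B.feval_closed[OF _ g]
  have "fdiff x y \<in> zspan (tens_rel R M rm N ln)" using eq by (simp add: tens_eq_def)
  \<comment> \<open>Membership in \<open>free_ab\<close> is carried along because additivity of
    \<open>feval\<close> is available only where all values lie in the carrier.\<close>
  then have "fdiff x y \<in> free_ab ?S \<and> feval B g (fdiff x y) = \<zero>\<^bsub>B\<^esub>"
  proof induction
    case (zspan_gen z)
    then show ?case
      by (auto simp: tens_rel_def ev closed left right bal rm ln a_minus_def B.r_neg)
  qed (auto simp: ev a_minus_def)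
  then have "feval B g x \<ominus>\<^bsub>B\<^esub> feval B g y = \<zero>\<^bsub>B\<^esub>"
    using tens_eq_carrier[OF eq] by (simp add: ev)
  then show ?thesis using tens_eq_carrier[OF eq] ev(3)
    by (metis B.minus_equality B.minus_minus B.a_inv_closed a_minus_def)
qed

section \<open>Projective modules\<close>

text \<open>Maps such as \<open>p \<mapsto> p \<otimes> q\<close> with \<open>q\<close> fixed are in
  general not linear over \<open>U\<close>; the manipulations of finite sums need only this weaker
  notion.\<close>

definition additive :: "('m, 'c) ring_scheme \<Rightarrow> ('n, 'd) ring_scheme \<Rightarrow> ('m \<Rightarrow> 'n) \<Rightarrow> bool" where
  "additive M N h \<longleftrightarrow> h \<in> carrier M \<rightarrow> carrier N \<and>
     (\<forall>m\<in>carrier M. \<forall>m'\<in>carrier M. h (m \<oplus>\<^bsub>M\<^esub> m') = h m \<oplus>\<^bsub>N\<^esub> h m')"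

lemma additiveD:
  assumes "additive M N h"
  shows "m \<in> carrier M \<Longrightarrow> h m \<in> carrier N"
    and "m \<in> carrier M \<Longrightarrow> m' \<in> carrier M \<Longrightarrow> h (m \<oplus>\<^bsub>M\<^esub> m') = h m \<oplus>\<^bsub>N\<^esub> h m'"
  using assms by (auto simp: additive_def)

lemma additive_zero:
  assumes "abelian_group M" "abelian_group N" "additive M N h"
  shows "h \<zero>\<^bsub>M\<^esub> = \<zero>\<^bsub>N\<^esub>"
proof -
  interpret M: abelian_group M by fact
  interpret N: abelian_group N by fact
  have "h \<zero>\<^bsub>M\<^esub> \<oplus>\<^bsub>N\<^esub> h \<zero>\<^bsub>M\<^esub> = h \<zero>\<^bsub>M\<^esub>"
    using additiveD(2)[OF assms(3), of "\<zero>\<^bsub>M\<^esub>" "\<zero>\<^bsub>M\<^esub>"] by simp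
  then show ?thesis using additiveD(1)[OF assms(3), of "\<zero>\<^bsub>M\<^esub>"] 
    by (metis M.zero_closed N.add.r_cancel_one)
qed

lemma additive_diff:
  assumes "abelian_group M" "abelian_group N" "additive M N h" "m \<in> carrier M" "m' \<in> carrier M"
  shows "h (m \<ominus>\<^bsub>M\<^esub> m') = h m \<ominus>\<^bsub>N\<^esub> h m'"
proof -
  interpret M: abelian_group M by fact
  interpret N: abelian_group N by fact
  note h = additiveD[OF assms(3)]
  have "h (\<ominus>\<^bsub>M\<^esub> m') \<oplus>\<^bsub>N\<^esub> h m' = \<zero>\<^bsub>N\<^esub>"
    using assms h(2)[of "\<ominus>\<^bsub>M\<^esub> m'" m'] by (simp add: additive_zero M.l_neg)
  then have "\<ominus>\<^bsub>N\<^esub> h m' = h (\<ominus>\<^bsub>M\<^esub> m')"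
    using assms h(1) by (intro N.minus_equality) auto
  then show ?thesis using assms h by (simp add: a_minus_def)
qed

lemma additive_finsum:
  assumes "abelian_group M" "abelian_group N" "additive M N h" "finite K" "f \<in> K \<rightarrow> carrier M"
  shows "h (finsum M f K) = finsum N (\<lambda>j. h (f j)) K"
proof -
  interpret M: abelian_group M by fact
  interpret N: abelian_group N by fact
  note h = additiveD[OF assms(3)]
  from assms(4,5) show ?thesis
    by (induction) (auto simp: additive_zero[OF assms(1-3)] h M.finsum_closed M.finsum_insert N.finsum_insert Pi_iff)
qed

context abelian_group
begin

lemma minus_eq_if_add_eq:
  "x \<in> carrier G \<Longrightarrow> y \<in> carrier G \<Longrightarrow> x \<oplus> y = z \<Longrightarrow> z \<ominus> y = x"
  by (auto simp: a_minus_def a_assoc r_neg)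

lemma finsum_Sigma:
  assumes "finite K" "\<And>j. j \<in> K \<Longrightarrow> finite (L j)"
    "\<And>j k. j \<in> K \<Longrightarrow> k \<in> L j \<Longrightarrow> f (j, k) \<in> carrier G"
  shows "finsum G f (Sigma K L) = (\<Oplus>j\<in>K. \<Oplus>k\<in>L j. f (j, k))"
  using assms
proof (induction K)
  case (insert j K)
  have eq: "Sigma (insert j K) L = Pair j ` L j \<union> Sigma K L" by auto
  have "finsum G f (Sigma (insert j K) L) = finsum G f (Pair j ` L j) \<oplus> finsum G f (Sigma K L)"
    unfolding eq by (rule finsum_Un_disjoint) (use insert in auto)
  moreover have "finsum G f (Pair j ` L j) = (\<Oplus>k\<in>L j. f (j, k))"
    by (rule finsum_reindex) (use insert in \<open>auto simp: inj_on_def\<close>)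
  ultimately show ?case using insert
    by (simp add: finsum_insert finsum_closed Pi_iff)
qed simp

lemma finsum_swap:
  assumes "finite K" "finite L" "\<And>j k. j \<in> K \<Longrightarrow> k \<in> L \<Longrightarrow> f j k \<in> carrier G"
  shows "(\<Oplus>j\<in>K. \<Oplus>k\<in>L. f j k) = (\<Oplus>k\<in>L. \<Oplus>j\<in>K. f j k)"
  using assms
proof (induction K)
  case (insert j K)
  then have "(\<Oplus>k\<in>L. \<Oplus>j\<in>insert j K. f j k) = (\<Oplus>k\<in>L. f j k \<oplus> (\<Oplus>j\<in>K. f j k))"
    by (intro finsum_cong') (auto simp: Pi_iff intro!: finsum_insert finsum_closed)
  with insert show ?case
    by (simp add: finsum_insert finsum_closed finsum_addf Pi_iff)
qed (simp add: finsum_zero)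

end

section \<open>Module homomorphisms and the regular module\<close>

lemma mod_hom_additive: "mod_hom R M N h \<Longrightarrow> additive M N h"
  by (auto simp: mod_hom_def additive_def)

lemma mod_hom_smult:
  "mod_hom R M N h \<Longrightarrow> r \<in> carrier R \<Longrightarrow> m \<in> carrier M \<Longrightarrow> h (r \<odot>\<^bsub>M\<^esub> m) = r \<odot>\<^bsub>N\<^esub> h m"
  by (auto simp: mod_hom_def)

lemma mod_hom_comp:
  "mod_hom R M N f \<Longrightarrow> mod_hom R N L g \<Longrightarrow> mod_hom R M L (\<lambda>m. g (f m))"
  by (auto simp: mod_hom_def Pi_iff)

lemma lmoduleD:
  assumes "lmodule R M"
  shows "ring R" "abelian_group M"
    "r \<in> carrier R \<Longrightarrow> m \<in> carrier M \<Longrightarrow> r \<odot>\<^bsub>M\<^esub> m \<in> carrier M"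
    "r \<in> carrier R \<Longrightarrow> r' \<in> carrier R \<Longrightarrow> m \<in> carrier M \<Longrightarrow>
      (r \<oplus>\<^bsub>R\<^esub> r') \<odot>\<^bsub>M\<^esub> m = r \<odot>\<^bsub>M\<^esub> m \<oplus>\<^bsub>M\<^esub> r' \<odot>\<^bsub>M\<^esub> m"
    "r \<in> carrier R \<Longrightarrow> m \<in> carrier M \<Longrightarrow> m' \<in> carrier M \<Longrightarrow>
      r \<odot>\<^bsub>M\<^esub> (m \<oplus>\<^bsub>M\<^esub> m') = r \<odot>\<^bsub>M\<^esub> m \<oplus>\<^bsub>M\<^esub> r \<odot>\<^bsub>M\<^esub> m'"
    "r \<in> carrier R \<Longrightarrow> r' \<in> carrier R \<Longrightarrow> m \<in> carrier M \<Longrightarrow>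
      (r \<otimes>\<^bsub>R\<^esub> r') \<odot>\<^bsub>M\<^esub> m = r \<odot>\<^bsub>M\<^esub> (r' \<odot>\<^bsub>M\<^esub> m)"
    "m \<in> carrier M \<Longrightarrow> \<one>\<^bsub>R\<^esub> \<odot>\<^bsub>M\<^esub> m = m"
  using assms by (auto simp: lmodule_def)

lemma additive_smult_left:
  "lmodule R M \<Longrightarrow> m \<in> carrier M \<Longrightarrow> additive R M (\<lambda>r. r \<odot>\<^bsub>M\<^esub> m)"
  by (simp add: additive_def lmoduleD)

lemma additive_smult_right:
  "lmodule R M \<Longrightarrow> r \<in> carrier R \<Longrightarrow> additive M M (\<lambda>m. r \<odot>\<^bsub>M\<^esub> m)"
  by (simp add: additive_def lmoduleD)

definition reg_mod :: "('r, 'c) ring_scheme \<Rightarrow> ('r, 'r) module" where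
  "reg_mod R = \<lparr>carrier = carrier R, mult = mult R, one = one R, zero = zero R,
     add = add R, smult = mult R\<rparr>"

lemma reg_mod_simps [simp]:
  "carrier (reg_mod R) = carrier R" "\<zero>\<^bsub>reg_mod R\<^esub> = \<zero>\<^bsub>R\<^esub>"
  "x \<oplus>\<^bsub>reg_mod R\<^esub> y = x \<oplus>\<^bsub>R\<^esub> y" "x \<odot>\<^bsub>reg_mod R\<^esub> y = x \<otimes>\<^bsub>R\<^esub> y"
  by (simp_all add: reg_mod_def)

lemma abelian_group_reg_mod: "ring R \<Longrightarrow> abelian_group (reg_mod R)"
proof -
  assume "ring R"
  then interpret ring R .
  show ?thesis
    by (rule abelian_groupI) (auto simp: a_assoc intro: a_comm l_neg bexI[of _ "\<ominus>\<^bsub>R\<^esub> _"])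
qed

lemma lmodule_reg_mod: "ring R \<Longrightarrow> lmodule R (reg_mod R)"
proof -
  assume R: "ring R"
  then interpret ring R .
  show ?thesis
    using R abelian_group_reg_mod[OF R] by (simp add: lmodule_def l_distr r_distr m_assoc)
qed

lemma mod_hom_reg_smult:
  "lmodule R M \<Longrightarrow> m \<in> carrier M \<Longrightarrow> mod_hom R (reg_mod R) M (\<lambda>r. r \<odot>\<^bsub>M\<^esub> m)"
  by (simp add: mod_hom_def lmoduleD)

text \<open>For \<open>N\<close> the regular module and \<open>b j r = r \<odot> x j\<close> this is a dual basis
  \<open>(x j, a j)\<close> of \<open>M\<close>; allowing other modules \<open>N\<close> makes dual bases composable.\<close>
definition decomposes_at :: "('m, 'c) ring_scheme \<Rightarrow> ('n, 'd) ring_scheme \<Rightarrow> 'j set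
    \<Rightarrow> ('j \<Rightarrow> 'm \<Rightarrow> 'n) \<Rightarrow> ('j \<Rightarrow> 'n \<Rightarrow> 'm) \<Rightarrow> 'm \<Rightarrow> bool" where
  "decomposes_at M N J a b m \<longleftrightarrow>
     (\<exists>K. finite K \<and> K \<subseteq> J \<and> (\<forall>j\<in>J - K. a j m = \<zero>\<^bsub>N\<^esub>) \<and> m = finsum M (\<lambda>j. b j (a j m)) K)"

text \<open>Equivalently, for modules: \<open>M\<close> is a retract of the direct sum of copies of
  \<open>N\<close> indexed by \<open>J\<close>. The finite set in \<open>decomposes_at\<close> makes
  the family \<open>a\<close> land in the direct sum and not just in the product.\<close>

definition decomposes_through :: "('r, 'c) ring_scheme \<Rightarrow> ('r, 'm) module \<Rightarrow> ('r, 'n) module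
    \<Rightarrow> 'j set \<Rightarrow> ('j \<Rightarrow> 'm \<Rightarrow> 'n) \<Rightarrow> ('j \<Rightarrow> 'n \<Rightarrow> 'm) \<Rightarrow> bool" where
  "decomposes_through R M N J a b \<longleftrightarrow>
     (\<forall>j\<in>J. mod_hom R M N (a j) \<and> mod_hom R N M (b j)) \<and>
     (\<forall>m\<in>carrier M. decomposes_at M N J a b m)"

lemma finsum_decomposition_superset:
  assumes "abelian_group M" "abelian_group N"
    and ab: "\<And>j. j \<in> J \<Longrightarrow> additive M N (a j)" "\<And>j. j \<in> J \<Longrightarrow> additive N M (b j)"
    and "m \<in> carrier M" "finite L" "K \<subseteq> L" "L \<subseteq> J" "\<And>j. j \<in> J - K \<Longrightarrow> a j m = \<zero>\<^bsub>N\<^esub>"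
  shows "finsum M (\<lambda>j. b j (a j m)) K = finsum M (\<lambda>j. b j (a j m)) L"
proof -
  interpret M: abelian_group M by fact
  show ?thesis
  proof (rule M.add.finprod_mono_neutral_cong_left)
    fix j assume j: "j \<in> L - K"
    then have "b j (a j m) = b j \<zero>\<^bsub>N\<^esub>" using assms by auto
    then show "b j (a j m) = \<zero>\<^bsub>M\<^esub>" using additive_zero[OF assms(2,1) ab(2)] j assms(8) by auto
  next
    show "(\<lambda>j. b j (a j m)) \<in> L \<rightarrow> carrier M"
      using assms(5,8) additiveD(1)[OF ab(1)] additiveD(1)[OF ab(2)] by blast
  qed (use assms in auto)
qed

text \<open>Two expansions can be compared over the union of their finite index sets. Consequently,
  in a module generated additively by pure tensors, the expansion has to be verified on pure tensors
  only.\<close>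

lemma decomposes_at_diff:
  assumes M: "abelian_group M" and N: "abelian_group N"
    and ab: "\<And>j. j \<in> J \<Longrightarrow> additive M N (a j)" "\<And>j. j \<in> J \<Longrightarrow> additive N M (b j)"
    and m: "m \<in> carrier M" "m' \<in> carrier M"
    and dec: "decomposes_at M N J a b m" "decomposes_at M N J a b m'"
  shows "decomposes_at M N J a b (m \<ominus>\<^bsub>M\<^esub> m')"
proof -
  interpret M: abelian_group M by fact
  interpret N: abelian_group N by fact
  obtain K where K: "finite K" "K \<subseteq> J" "\<forall>j\<in>J - K. a j m = \<zero>\<^bsub>N\<^esub>" "m = finsum M (\<lambda>j. b j (a j m)) K"
    using dec(1) by (auto simp: decomposes_at_def)
  obtain K' where K': "finite K'" "K' \<subseteq> J" "\<forall>j\<in>J - K'. a j m' = \<zero>\<^bsub>N\<^esub>"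
      "m' = finsum M (\<lambda>j. b j (a j m')) K'"
    using dec(2) by (auto simp: decomposes_at_def)
  let ?L = "K \<union> K'"
  have L: "finite ?L" "?L \<subseteq> J" using K K' by auto
  have c: "a j x \<in> carrier N" "b j (a j x) \<in> carrier M" if "j \<in> ?L" "x \<in> carrier M" for j x
    using that L(2) additiveD(1)[OF ab(1)] additiveD(1)[OF ab(2)] by blast+
  have mL: "m = finsum M (\<lambda>j. b j (a j m)) ?L"
    using finsum_decomposition_superset[OF M N ab m(1) L(1) _ L(2), where K = K] K by simp
  have m'L: "m' = finsum M (\<lambda>j. b j (a j m')) ?L"
    using finsum_decomposition_superset[OF M N ab m(2) L(1) _ L(2), where K = K'] K' by simp
  have ba: "b j (a j (m \<ominus>\<^bsub>M\<^esub> m')) \<oplus>\<^bsub>M\<^esub> b j (a j m') = b j (a j m)" if "j \<in> ?L" for j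
  proof -
    have j: "j \<in> J" using that L by auto
    have "b j (a j (m \<ominus>\<^bsub>M\<^esub> m')) \<oplus>\<^bsub>M\<^esub> b j (a j m') = b j (a j ((m \<ominus>\<^bsub>M\<^esub> m') \<oplus>\<^bsub>M\<^esub> m'))"
      using m j c(1)[OF that] additiveD(2)[OF ab(1)[OF j]] additiveD(2)[OF ab(2)[OF j]] by simp
    also have "(m \<ominus>\<^bsub>M\<^esub> m') \<oplus>\<^bsub>M\<^esub> m' = m"
      using m by (simp add: a_minus_def M.a_assoc M.l_neg)
    finally show ?thesis .
  qed
  \<comment> \<open>Finite sums split along addition, so the claim is proved after adding
    \<open>m'\<close> to both sides.\<close>
  have "finsum M (\<lambda>j. b j (a j (m \<ominus>\<^bsub>M\<^esub> m'))) ?L \<oplus>\<^bsub>M\<^esub> m' = m"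
  proof -
    have "finsum M (\<lambda>j. b j (a j (m \<ominus>\<^bsub>M\<^esub> m'))) ?L \<oplus>\<^bsub>M\<^esub> m' =
        finsum M (\<lambda>j. b j (a j (m \<ominus>\<^bsub>M\<^esub> m')) \<oplus>\<^bsub>M\<^esub> b j (a j m')) ?L"
      by (subst m'L, subst M.finsum_addf) (use c m in auto)
    also have "\<dots> = m"
      by (subst mL, rule M.finsum_cong') (use c m ba in auto)
    finally show ?thesis .
  qed
  moreover have "finsum M (\<lambda>j. b j (a j (m \<ominus>\<^bsub>M\<^esub> m'))) ?L \<in> carrier M"
    by (rule M.finsum_closed) (use c m in auto)
  ultimately have "m \<ominus>\<^bsub>M\<^esub> m' = finsum M (\<lambda>j. b j (a j (m \<ominus>\<^bsub>M\<^esub> m'))) ?L"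
    using m(2) M.minus_eq_if_add_eq by metis
  moreover have "\<forall>j\<in>J - ?L. a j (m \<ominus>\<^bsub>M\<^esub> m') = \<zero>\<^bsub>N\<^esub>"
    using K(3) K'(3) additive_diff[OF M N ab(1) m] by (simp add: a_minus_def)
  ultimately show ?thesis using L unfolding decomposes_at_def by blast
qed

lemma decomposes_at_zero:
  assumes "abelian_group M" "abelian_group N" "\<And>j. j \<in> J \<Longrightarrow> additive M N (a j)"
  shows "decomposes_at M N J a b \<zero>\<^bsub>M\<^esub>"
proof -
  interpret M: abelian_group M by fact
  show ?thesis
    unfolding decomposes_at_def
    by (rule exI[of _ "{}"]) (use additive_zero[OF assms(1,2) assms(3)] in auto)
qed

text \<open>A retract of a sum of retracts is a retract. The finite set \<open>K' j\<close> needed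
  for \<open>a j m\<close> varies with \<open>j\<close>, but only the finitely many \<open>j\<close>
  in \<open>K\<close> matter: for all others \<open>a j m\<close> is zero and every
  \<open>c k\<close> kills it. Hence the finite set \<open>Sigma K K'\<close> suffices.\<close>

lemma decomposes_through_trans:
  assumes "abelian_group M" "abelian_group N" "abelian_group L"
    and MN: "decomposes_through R M N J a b" and NL: "decomposes_through R N L J' c d"
  shows "decomposes_through R M L (J \<times> J') (\<lambda>(j, k) m. c k (a j m)) (\<lambda>(j, k) l. b j (d k l))"
proof -
  interpret M: abelian_group M by fact
  interpret N: abelian_group N by fact
  have ab: "additive M N (a j)" "additive N M (b j)" if "j \<in> J" for j
    using MN that by (auto simp: decomposes_through_def intro: mod_hom_additive)
  have cd: "additive N L (c k)" "additive L N (d k)" if "k \<in> J'" for k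
    using NL that by (auto simp: decomposes_through_def intro: mod_hom_additive)
  have "decomposes_at M L (J \<times> J') (\<lambda>(j, k) m. c k (a j m)) (\<lambda>(j, k) l. b j (d k l)) m"
    if m: "m \<in> carrier M" for m
  proof -
    obtain K where K: "finite K" "K \<subseteq> J" "\<forall>j\<in>J - K. a j m = \<zero>\<^bsub>N\<^esub>" "m = finsum M (\<lambda>j. b j (a j m)) K"
      using MN m unfolding decomposes_through_def decomposes_at_def by blast
    have am: "a j m \<in> carrier N" if "j \<in> J" for j using additiveD(1)[OF ab(1)] that m by blast
    have "\<exists>K'. finite K' \<and> K' \<subseteq> J' \<and> (\<forall>k\<in>J' - K'. c k (a j m) = \<zero>\<^bsub>L\<^esub>) \<and>
        a j m = finsum N (\<lambda>k. d k (c k (a j m))) K'" if "j \<in> J" for j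
      using NL am[OF that] unfolding decomposes_through_def decomposes_at_def by blast
    then obtain K' where K': "\<And>j. j \<in> J \<Longrightarrow> finite (K' j)" "\<And>j. j \<in> J \<Longrightarrow> K' j \<subseteq> J'"
      "\<And>j k. j \<in> J \<Longrightarrow> k \<in> J' \<Longrightarrow> k \<notin> K' j \<Longrightarrow> c k (a j m) = \<zero>\<^bsub>L\<^esub>"
      "\<And>j. j \<in> J \<Longrightarrow> a j m = finsum N (\<lambda>k. d k (c k (a j m))) (K' j)"
      by (metis DiffI)
    have cl: "d k (c k (a j m)) \<in> carrier N" "b j (d k (c k (a j m))) \<in> carrier M"
      if "j \<in> J" "k \<in> J'" for j k
      using that am additiveD(1)[OF cd(1)] additiveD(1)[OF cd(2)] additiveD(1)[OF ab(2)] by blast+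
    have "b j (a j m) = finsum M (\<lambda>k. b j (d k (c k (a j m)))) (K' j)" if "j \<in> J" for j
      by (subst K'(4)[OF that], rule additive_finsum)
         (use assms that ab K' cl in \<open>auto simp: subset_iff\<close>)
    then have "m = finsum M (\<lambda>j. finsum M (\<lambda>k. b j (d k (c k (a j m)))) (K' j)) K"
      by (subst K(4), intro M.finsum_cong')
         (use K K' cl in \<open>auto intro!: M.finsum_closed simp: subset_iff\<close>)
    also have "\<dots> = finsum M (\<lambda>(j, k). b j (d k (c k (a j m)))) (Sigma K K')"
      by (subst M.finsum_Sigma) (use K K' cl in \<open>auto simp: subset_iff\<close>)
    finally have "m = finsum M (\<lambda>x. (case x of (j, k) \<Rightarrow> \<lambda>l. b j (d k l))
        ((case x of (j, k) \<Rightarrow> \<lambda>m. c k (a j m)) m)) (Sigma K K')"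
      by (simp add: split_def)
    moreover have "c k (a j m) = \<zero>\<^bsub>L\<^esub>" if "(j, k) \<in> J \<times> J' - Sigma K K'" for j k
      using that K(3) K'(3) additive_zero[OF assms(2,3) cd(1)] by (cases "j \<in> K") auto
    moreover have "finite (Sigma K K')" "Sigma K K' \<subseteq> J \<times> J'"
      using K K'(1) K'(2)[THEN subsetD] by auto
    ultimately show ?thesis unfolding decomposes_at_def
      by (intro exI[of _ "Sigma K K'"]) auto
  qed
  moreover have "mod_hom R M L (\<lambda>m. c k (a j m)) \<and> mod_hom R L M (\<lambda>l. b j (d k l))"
    if "j \<in> J" "k \<in> J'" for j k
    using MN NL that by (auto simp: decomposes_through_def intro: mod_hom_comp)
  ultimately show ?thesis by (auto simp: decomposes_through_def)
qed

section \<open>Dual bases and projectivity\<close>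

lemma free_lmod_carrier:
  "f \<in> carrier (free_lmod R I) \<longleftrightarrow>
    (\<forall>i\<in>I. f i \<in> carrier R) \<and> (\<forall>i. i \<notin> I \<longrightarrow> f i = \<zero>\<^bsub>R\<^esub>) \<and> finite {i. f i \<noteq> \<zero>\<^bsub>R\<^esub>}"
  by (simp add: free_lmod_def)

lemma free_lmod_simps [simp]:
  "f \<oplus>\<^bsub>free_lmod R I\<^esub> g = (\<lambda>i. f i \<oplus>\<^bsub>R\<^esub> g i)" "r \<odot>\<^bsub>free_lmod R I\<^esub> f = (\<lambda>i. r \<otimes>\<^bsub>R\<^esub> f i)"
  "\<zero>\<^bsub>free_lmod R I\<^esub> = (\<lambda>i. \<zero>\<^bsub>R\<^esub>)"
  by (simp_all add: free_lmod_def)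

text \<open>The functionals are the coordinates of the embedding \<open>i\<close>; the maps back
  send \<open>r\<close> to the image under \<open>p\<close> of \<open>r\<close> times a unit vector,
  which is \<open>single j r\<close>.\<close>

lemma lprojective_imp_decomposes_through:
  fixes M :: "('r, 'm) module"
  assumes "lprojective R M"
  obtains J :: "'m set" and a b where "decomposes_through R M (reg_mod R) J a b"
proof -
  obtain I :: "'m set" and i p where i: "mod_hom R M (free_lmod R I) i" and p: "mod_hom R (free_lmod R I) M p"
    and pi: "\<And>m. m \<in> carrier M \<Longrightarrow> p (i m) = m" and M: "lmodule R M"
    using assms by (auto simp: lprojective_def)
  interpret R: ring R using M by (rule lmoduleD)
  interpret M: abelian_group M using M by (rule lmoduleD)
  define single :: "'m \<Rightarrow> 'r \<Rightarrow> 'm \<Rightarrow> 'r" where "single = (\<lambda>j r x. if x = j then r else \<zero>\<^bsub>R\<^esub>)"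
  have single: "single j r \<in> carrier (free_lmod R I)" if "j \<in> I" "r \<in> carrier R" for j r
    using that by (auto simp: free_lmod_carrier single_def)
  \<comment> \<open>Additivity of \<open>p\<close> and cancellation in \<open>M\<close> are enough,
    so no group structure on the free module has to be established.\<close>
  have p0: "p (\<lambda>i. \<zero>\<^bsub>R\<^esub>) = \<zero>\<^bsub>M\<^esub>"
  proof -
    have z: "(\<lambda>i. \<zero>\<^bsub>R\<^esub>) \<in> carrier (free_lmod R I)" by (simp add: free_lmod_carrier)
    have "p (\<lambda>i. \<zero>\<^bsub>R\<^esub>) \<oplus>\<^bsub>M\<^esub> p (\<lambda>i. \<zero>\<^bsub>R\<^esub>) = p (\<lambda>i. \<zero>\<^bsub>R\<^esub>)"
      using additiveD(2)[OF mod_hom_additive[OF p] z z] by simp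
    then show ?thesis using additiveD(1)[OF mod_hom_additive[OF p] z]
      by (metis M.add.r_cancel_one)
  qed
  have psum: "p f = finsum M (\<lambda>j. p (single j (f j))) K"
    if "finite K" "K \<subseteq> I" "f \<in> carrier (free_lmod R I)" "\<And>j. j \<notin> K \<Longrightarrow> f j = \<zero>\<^bsub>R\<^esub>" for f K
    using that
  proof (induction K arbitrary: f rule: finite_induct)
    case empty
    then have "f = (\<lambda>i. \<zero>\<^bsub>R\<^esub>)" by auto
    then show ?case using p0 by simp
  next
    case (insert j K)
    let ?g = "f(j := \<zero>\<^bsub>R\<^esub>)"
    have fR: "f x \<in> carrier R" for x using insert.prems(2) by (cases "x \<in> I") (auto simp: free_lmod_carrier)
    have g: "?g \<in> carrier (free_lmod R I)"
    proof -
      have "finite {i. ?g i \<noteq> \<zero>\<^bsub>R\<^esub>}"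
        by (rule finite_subset[OF _ insert.hyps(1)]) (use insert.prems in auto)
      then show ?thesis using fR insert.prems by (auto simp: free_lmod_carrier)
    qed
    have f: "f = single j (f j) \<oplus>\<^bsub>free_lmod R I\<^esub> ?g"
      using fR by (auto simp: single_def)
    have ps: "p (single x (f x)) \<in> carrier M" if "x \<in> I" for x
      using additiveD(1)[OF mod_hom_additive[OF p] single] that fR by blast
    have "p ?g = finsum M (\<lambda>x. p (single x (?g x))) K"
      by (rule insert.IH[OF _ g]) (use insert.prems in auto)
    also have "\<dots> = finsum M (\<lambda>x. p (single x (f x))) K"
      by (rule M.finsum_cong') (use insert ps in auto)
    finally have "p f = p (single j (f j)) \<oplus>\<^bsub>M\<^esub> finsum M (\<lambda>x. p (single x (f x))) K"
      using insert.prems additiveD(2)[OF mod_hom_additive[OF p] single g] fR f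
      by (metis insert_subset)
    then show ?case using insert ps
      by (subst M.finsum_insert) auto
  qed
  have "decomposes_through R M (reg_mod R) I (\<lambda>j m. i m j) (\<lambda>j r. p (single j r))"
    unfolding decomposes_through_def
  proof (intro conjI ballI)
    fix j assume j: "j \<in> I"
    have ic: "i m \<in> carrier (free_lmod R I)" if "m \<in> carrier M" for m
      using additiveD(1)[OF mod_hom_additive[OF i] that] .
    show "mod_hom R M (reg_mod R) (\<lambda>m. i m j)"
      using i j ic by (auto simp: mod_hom_def free_lmod_carrier)
    have "single j (r \<oplus>\<^bsub>R\<^esub> r') = single j r \<oplus>\<^bsub>free_lmod R I\<^esub> single j r'"
      "single j (r \<otimes>\<^bsub>R\<^esub> r') = r \<odot>\<^bsub>free_lmod R I\<^esub> single j r'"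
      if "r \<in> carrier R" "r' \<in> carrier R" for r r'
      using that by (auto simp: single_def)
    then show "mod_hom R (reg_mod R) M (\<lambda>r. p (single j r))"
      using p single j unfolding mod_hom_def Pi_iff by (metis reg_mod_simps(1,3,4))
  next
    fix m assume m: "m \<in> carrier M"
    have im: "i m \<in> carrier (free_lmod R I)"
      using additiveD(1)[OF mod_hom_additive[OF i] m] .
    let ?K = "{j. i m j \<noteq> \<zero>\<^bsub>R\<^esub>}"
    have K: "finite ?K" "?K \<subseteq> I" using im by (auto simp: free_lmod_carrier)
    have "m = finsum M (\<lambda>j. p (single j (i m j))) ?K"
      using psum[OF K im] pi[OF m] by simp
    then show "decomposes_at M (reg_mod R) I (\<lambda>j m. i m j) (\<lambda>j r. p (single j r)) m"
      unfolding decomposes_at_def using K by (intro exI[of _ ?K]) auto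
  qed
  then show ?thesis using that by blast
qed


text \<open>The index type of the dual basis is arbitrary, while \<open>lprojective\<close> wants
  indices of the element type of \<open>M\<close>. The basis is therefore indexed by its own
  elements, inside the free module on all of \<open>carrier M\<close>. Since
  \<open>j \<mapsto> x j\<close> may fail to be injective, functionals belonging to the same element
  are added up.\<close>

lemma lprojective_if_decomposes_through:
  assumes M: "lmodule R M" and dec: "decomposes_through R M (reg_mod R) J h b"
  shows "lprojective R M"
proof -
  interpret R: ring R using M by (rule lmoduleD)
  interpret M: abelian_group M using M by (rule lmoduleD)
  define x where "x j = b j \<one>\<^bsub>R\<^esub>" for j
  have hom: "mod_hom R M (reg_mod R) (h j)" "mod_hom R (reg_mod R) M (b j)" if "j \<in> J" for j
    using dec that by (auto simp: decomposes_through_def)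
  have h: "h j m \<in> carrier R" if "j \<in> J" "m \<in> carrier M" for j m
    using hom(1)[OF that(1)] that(2) by (auto simp: mod_hom_def)
  have x: "x j \<in> carrier M" if "j \<in> J" for j
    using hom(2)[OF that] by (auto simp: mod_hom_def x_def)
  have b: "b j r = r \<odot>\<^bsub>M\<^esub> x j" if "j \<in> J" "r \<in> carrier R" for j r
    using mod_hom_smult[OF hom(2)[OF that(1)] that(2), of "\<one>\<^bsub>R\<^esub>"] that(2) by (simp add: x_def)
  \<comment> \<open>The finite set supplied by the decomposition is a mere choice for each
    \<open>m\<close>; the exact support is determined by \<open>m\<close> and can be used in a
    definition.\<close>
  define S where "S m = {j \<in> J. h j m \<noteq> \<zero>\<^bsub>R\<^esub>}" for m
  have S: "finite (S m)" "m = finsum M (\<lambda>j. h j m \<odot>\<^bsub>M\<^esub> x j) (S m)" if m: "m \<in> carrier M" for m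
  proof -
    obtain K where K: "finite K" "K \<subseteq> J" "\<forall>j\<in>J - K. h j m = \<zero>\<^bsub>R\<^esub>" "m = finsum M (\<lambda>j. b j (h j m)) K"
      using dec m unfolding decomposes_through_def decomposes_at_def by fastforce
    have SK: "S m \<subseteq> K" using K(3) by (auto simp: S_def)
    then show "finite (S m)" using K(1) by (rule finite_subset)
    have "finsum M (\<lambda>j. b j (h j m)) (S m) = finsum M (\<lambda>j. b j (h j m)) K"
      by (rule finsum_decomposition_superset[where J = J and N = "reg_mod R"])
         (use M.abelian_group_axioms lmoduleD(1)[OF M] m K SK mod_hom_additive[OF hom(1)]
            mod_hom_additive[OF hom(2)] in \<open>auto simp: S_def abelian_group_reg_mod\<close>)
    then have "m = finsum M (\<lambda>j. b j (h j m)) (S m)" using K(4) by simp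
    also have "\<dots> = finsum M (\<lambda>j. h j m \<odot>\<^bsub>M\<^esub> x j) (S m)"
      by (rule M.finsum_cong') (use m h x b lmoduleD(3)[OF M] in \<open>auto simp: S_def\<close>)
    finally show "m = finsum M (\<lambda>j. h j m \<odot>\<^bsub>M\<^esub> x j) (S m)" .
  qed
  \<comment> \<open>The coefficient at \<open>y\<close> collects all functionals over the fibre of
    \<open>x\<close> above \<open>y\<close>; \<open>p\<close> below is the canonical projection
    sending the unit vector at \<open>y\<close> to \<open>y\<close>.\<close>
  define i where "i m y = finsum R (\<lambda>j. if x j = y then h j m else \<zero>\<^bsub>R\<^esub>) (S m)" for m y
  define p where "p f = finsum M (\<lambda>y. f y \<odot>\<^bsub>M\<^esub> y) {y. f y \<noteq> \<zero>\<^bsub>R\<^esub>}" for f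
  let ?F = "free_lmod R (carrier M)"
  have i_sup: "i m y = finsum R (\<lambda>j. if x j = y then h j m else \<zero>\<^bsub>R\<^esub>) K"
    if "m \<in> carrier M" "finite K" "K \<subseteq> J" "S m \<subseteq> K" for m y K
    unfolding i_def
    by (rule R.add.finprod_mono_neutral_cong_left) (use that h in \<open>auto simp: S_def\<close>)
  have iR: "i m y \<in> carrier R" if "m \<in> carrier M" for m y
    unfolding i_def by (rule R.finsum_closed) (use that h in \<open>auto simp: S_def\<close>)
  have i0: "i m y = \<zero>\<^bsub>R\<^esub>" if "y \<notin> x ` S m" for m y
  proof -
    have "i m y = finsum R (\<lambda>j. \<zero>\<^bsub>R\<^esub>) (S m)"
      unfolding i_def by (rule R.finsum_cong') (use that in auto)
    then show ?thesis by (simp add: R.finsum_zero)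
  qed
  have iF: "i m \<in> carrier ?F" if m: "m \<in> carrier M" for m
  proof -
    have "x ` S m \<subseteq> carrier M" using x by (auto simp: S_def)
    moreover have "finite {y. i m y \<noteq> \<zero>\<^bsub>R\<^esub>}"
      by (rule finite_subset[of _ "x ` S m"]) (use i0 S(1)[OF m] in auto)
    moreover have "i m y = \<zero>\<^bsub>R\<^esub>" if "y \<notin> carrier M" for y
      by (rule i0) (use x that in \<open>auto simp: S_def\<close>)
    ultimately show ?thesis using iR[OF m] by (auto simp: free_lmod_carrier)
  qed
  have "mod_hom R M ?F i"
    unfolding mod_hom_def
  proof (intro conjI ballI)
    show "i \<in> carrier M \<rightarrow> carrier ?F" using iF by auto
  next
    fix m m' assume m: "m \<in> carrier M" "m' \<in> carrier M"
    \<comment> \<open>One finite set serving all three arguments, so that the three sums can be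
      compared term by term.\<close>
    let ?K = "S m \<union> S m' \<union> S (m \<oplus>\<^bsub>M\<^esub> m')"
    have K: "finite ?K" "?K \<subseteq> J" using S(1) m by (auto simp: S_def)
    have sub: "S m \<subseteq> ?K" "S m' \<subseteq> ?K" by auto
    have "i (m \<oplus>\<^bsub>M\<^esub> m') y = i m y \<oplus>\<^bsub>R\<^esub> i m' y" for y
    proof -
      have "i (m \<oplus>\<^bsub>M\<^esub> m') y = finsum R (\<lambda>j. (if x j = y then h j m else \<zero>\<^bsub>R\<^esub>) \<oplus>\<^bsub>R\<^esub>
          (if x j = y then h j m' else \<zero>\<^bsub>R\<^esub>)) ?K"
        unfolding i_sup[OF M.a_closed[OF m] K Un_upper2]
        by (rule R.finsum_cong')
           (use m K h additiveD(2)[OF mod_hom_additive[OF hom(1)]] in \<open>auto dest: subsetD\<close>)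
      also have "\<dots> = i m y \<oplus>\<^bsub>R\<^esub> i m' y"
        unfolding i_sup[OF m(1) K sub(1)] i_sup[OF m(2) K sub(2)]
        by (rule R.finsum_addf) (use m K h in \<open>auto dest: subsetD\<close>)
      finally show ?thesis .
    qed
    then show "i (m \<oplus>\<^bsub>M\<^esub> m') = i m \<oplus>\<^bsub>?F\<^esub> i m'" by auto
  next
    fix r m assume r: "r \<in> carrier R" and m: "m \<in> carrier M"
    have rm: "r \<odot>\<^bsub>M\<^esub> m \<in> carrier M" using lmoduleD(3)[OF M r m] .
    have hr: "h j (r \<odot>\<^bsub>M\<^esub> m) = r \<otimes>\<^bsub>R\<^esub> h j m" if "j \<in> J" for j
      using mod_hom_smult[OF hom(1)[OF that] r m] by simp
    have sub: "S (r \<odot>\<^bsub>M\<^esub> m) \<subseteq> S m" using hr r by (auto simp: S_def)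
    have K: "finite (S m)" "S m \<subseteq> J" using S(1) m by (auto simp: S_def)
    have "i (r \<odot>\<^bsub>M\<^esub> m) y = r \<otimes>\<^bsub>R\<^esub> i m y" for y
      unfolding i_sup[OF rm K sub] unfolding i_def
      by (subst R.finsum_rdistr[OF K(1) r])
         (use h m r hr in \<open>auto simp: S_def intro!: R.finsum_cong'\<close>)
    then show "i (r \<odot>\<^bsub>M\<^esub> m) = r \<odot>\<^bsub>?F\<^esub> i m" by auto
  qed
  moreover have z: "\<zero>\<^bsub>R\<^esub> \<odot>\<^bsub>M\<^esub> m = \<zero>\<^bsub>M\<^esub>" if "m \<in> carrier M" for m
    using additive_zero[OF R.abelian_group_axioms M.abelian_group_axioms additive_smult_left[OF M that]] .
  have fR: "f y \<in> carrier R" if "f \<in> carrier ?F" for f y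
    using that by (cases "y \<in> carrier M") (auto simp: free_lmod_carrier)
  have p_sup: "p f = finsum M (\<lambda>y. f y \<odot>\<^bsub>M\<^esub> y) K"
    if "f \<in> carrier ?F" "finite K" "K \<subseteq> carrier M" "{y. f y \<noteq> \<zero>\<^bsub>R\<^esub>} \<subseteq> K" for f K
    unfolding p_def
    by (rule M.add.finprod_mono_neutral_cong_left)
       (use that fR z lmoduleD(3)[OF M] in \<open>auto dest: subsetD\<close>)
  have supp: "finite {y. f y \<noteq> \<zero>\<^bsub>R\<^esub>}" "{y. f y \<noteq> \<zero>\<^bsub>R\<^esub>} \<subseteq> carrier M" if "f \<in> carrier ?F" for f
    using that by (auto simp: free_lmod_carrier)
  have "mod_hom R ?F M p"
    unfolding mod_hom_def
  proof (intro conjI ballI)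
    show "p \<in> carrier ?F \<rightarrow> carrier M"
    proof
      fix f assume f: "f \<in> carrier ?F"
      show "p f \<in> carrier M"
        unfolding p_def
        by (rule M.finsum_closed) (use supp(2)[OF f] fR[OF f] lmoduleD(3)[OF M] in \<open>auto dest: subsetD\<close>)
    qed
  next
    fix f g assume f: "f \<in> carrier ?F" and g: "g \<in> carrier ?F"
    let ?K = "{y. f y \<noteq> \<zero>\<^bsub>R\<^esub>} \<union> {y. g y \<noteq> \<zero>\<^bsub>R\<^esub>}"
    have K: "finite ?K" "?K \<subseteq> carrier M" using supp f g by auto
    have sub: "{y. f y \<oplus>\<^bsub>R\<^esub> g y \<noteq> \<zero>\<^bsub>R\<^esub>} \<subseteq> ?K" by auto
    have fg: "(\<lambda>y. f y \<oplus>\<^bsub>R\<^esub> g y) \<in> carrier ?F"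
      using f g finite_subset[OF sub K(1)] by (auto simp: free_lmod_carrier)
    have "p (\<lambda>y. f y \<oplus>\<^bsub>R\<^esub> g y) = finsum M (\<lambda>y. f y \<odot>\<^bsub>M\<^esub> y \<oplus>\<^bsub>M\<^esub> g y \<odot>\<^bsub>M\<^esub> y) ?K"
      unfolding p_sup[OF fg K sub]
      by (rule M.finsum_cong')
         (use K fR[OF f] fR[OF g] lmoduleD(3,4)[OF M] in \<open>auto dest: subsetD\<close>)
    also have "\<dots> = p f \<oplus>\<^bsub>M\<^esub> p g"
      unfolding p_sup[OF f K Un_upper1] p_sup[OF g K Un_upper2]
      by (rule M.finsum_addf)
         (use K fR[OF f] fR[OF g] lmoduleD(3)[OF M] in \<open>auto dest: subsetD\<close>)
    finally show "p (f \<oplus>\<^bsub>?F\<^esub> g) = p f \<oplus>\<^bsub>M\<^esub> p g" by simp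
  next
    fix r f assume r: "r \<in> carrier R" and f: "f \<in> carrier ?F"
    note K = supp[OF f]
    have sub: "{y. r \<otimes>\<^bsub>R\<^esub> f y \<noteq> \<zero>\<^bsub>R\<^esub>} \<subseteq> {y. f y \<noteq> \<zero>\<^bsub>R\<^esub>}" using r by auto
    have rf: "(\<lambda>y. r \<otimes>\<^bsub>R\<^esub> f y) \<in> carrier ?F"
      using f r finite_subset[OF sub K(1)] by (auto simp: free_lmod_carrier)
    have "p (\<lambda>y. r \<otimes>\<^bsub>R\<^esub> f y) = finsum M (\<lambda>y. r \<odot>\<^bsub>M\<^esub> (f y \<odot>\<^bsub>M\<^esub> y)) {y. f y \<noteq> \<zero>\<^bsub>R\<^esub>}"
      unfolding p_sup[OF rf K sub]
      by (rule M.finsum_cong')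
         (use K r fR[OF f] lmoduleD(3,6)[OF M] in \<open>auto dest: subsetD\<close>)
    also have "\<dots> = r \<odot>\<^bsub>M\<^esub> p f"
      unfolding p_def
      by (rule additive_finsum[OF M.abelian_group_axioms M.abelian_group_axioms
            additive_smult_right[OF M r] K(1), symmetric])
         (use K r fR[OF f] lmoduleD(3)[OF M] in \<open>auto dest: subsetD\<close>)
    finally show "p (r \<odot>\<^bsub>?F\<^esub> f) = r \<odot>\<^bsub>M\<^esub> p f" by simp
  qed
  \<comment> \<open>This is a regrouping of the expansion of \<open>m\<close> by the values of
    \<open>x\<close>. After interchanging the two sums, each \<open>j\<close> meets exactly one
    \<open>y\<close>, namely \<open>x j\<close>.\<close>
  moreover have "p (i m) = m" if m: "m \<in> carrier M" for m
  proof -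
    let ?L = "x ` S m"
    have K: "finite (S m)" "S m \<subseteq> J" using S(1) m by (auto simp: S_def)
    have L: "finite ?L" "?L \<subseteq> carrier M" using K x by auto
    have cl: "h j m \<odot>\<^bsub>M\<^esub> x j \<in> carrier M" if "j \<in> S m" for j
      using that h x m K lmoduleD(3)[OF M] by (auto simp: S_def)
    have sub: "{y. i m y \<noteq> \<zero>\<^bsub>R\<^esub>} \<subseteq> ?L" using i0 by auto
    have "p (i m) = finsum M (\<lambda>y. i m y \<odot>\<^bsub>M\<^esub> y) ?L"
      by (rule p_sup[OF iF[OF m] L sub])
    also have "\<dots> = finsum M (\<lambda>y. finsum M (\<lambda>j. if x j = y then h j m \<odot>\<^bsub>M\<^esub> x j else \<zero>\<^bsub>M\<^esub>) (S m)) ?L"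
    proof (rule M.finsum_cong')
      fix y assume y: "y \<in> ?L"
      then have yM: "y \<in> carrier M" using L by auto
      have "i m y \<odot>\<^bsub>M\<^esub> y = finsum M (\<lambda>j. (if x j = y then h j m else \<zero>\<^bsub>R\<^esub>) \<odot>\<^bsub>M\<^esub> y) (S m)"
        unfolding i_def
        by (rule additive_finsum[OF R.abelian_group_axioms M.abelian_group_axioms
              additive_smult_left[OF M yM] K(1)])
           (use h m K in \<open>auto dest: subsetD\<close>)
      also have "\<dots> = finsum M (\<lambda>j. if x j = y then h j m \<odot>\<^bsub>M\<^esub> x j else \<zero>\<^bsub>M\<^esub>) (S m)"
        by (rule M.finsum_cong') (use cl z yM in auto)
      finally show "i m y \<odot>\<^bsub>M\<^esub> y =
          finsum M (\<lambda>j. if x j = y then h j m \<odot>\<^bsub>M\<^esub> x j else \<zero>\<^bsub>M\<^esub>) (S m)" .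
    next
      show "(\<lambda>y. finsum M (\<lambda>j. if x j = y then h j m \<odot>\<^bsub>M\<^esub> x j else \<zero>\<^bsub>M\<^esub>) (S m)) \<in> ?L \<rightarrow> carrier M"
        by (intro funcsetI M.finsum_closed) (metis cl M.zero_closed)
    qed simp
    also have "\<dots> = finsum M (\<lambda>j. finsum M (\<lambda>y. if x j = y then h j m \<odot>\<^bsub>M\<^esub> x j else \<zero>\<^bsub>M\<^esub>) ?L) (S m)"
      by (rule M.finsum_swap[OF L(1) K(1)]) (metis cl M.zero_closed)
    also have "\<dots> = finsum M (\<lambda>j. h j m \<odot>\<^bsub>M\<^esub> x j) (S m)"
    proof (rule M.finsum_cong')
      fix j assume j: "j \<in> S m"
      show "finsum M (\<lambda>y. if x j = y then h j m \<odot>\<^bsub>M\<^esub> x j else \<zero>\<^bsub>M\<^esub>) ?L = h j m \<odot>\<^bsub>M\<^esub> x j"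
        by (rule M.finsum_singleton) (use j cl L in auto)
    qed (use cl in auto)
    also have "\<dots> = m" using S(2)[OF m] by simp
    finally show ?thesis .
  qed
  ultimately show ?thesis unfolding lprojective_def using M by blast
qed

section \<open>Right modules as left modules over the opposite ring\<close>

definition op_ring :: "('r, 'c) ring_scheme \<Rightarrow> ('r, 'c) ring_scheme" where
  "op_ring R = R\<lparr>mult := \<lambda>x y. y \<otimes>\<^bsub>R\<^esub> x\<rparr>"

lemma op_ring_simps [simp]:
  "carrier (op_ring R) = carrier R" "\<zero>\<^bsub>op_ring R\<^esub> = \<zero>\<^bsub>R\<^esub>" "\<one>\<^bsub>op_ring R\<^esub> = \<one>\<^bsub>R\<^esub>"
  "x \<oplus>\<^bsub>op_ring R\<^esub> y = x \<oplus>\<^bsub>R\<^esub> y" "x \<otimes>\<^bsub>op_ring R\<^esub> y = y \<otimes>\<^bsub>R\<^esub> x"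
  by (simp_all add: op_ring_def)

lemma ring_op_ring: "ring R \<Longrightarrow> ring (op_ring R)"
proof -
  assume "ring R"
  then interpret ring R .
  have "abelian_group (op_ring R)"
    using a_comm_monoid a_comm_group
    by (simp add: abelian_group_def abelian_group_axioms_def abelian_monoid_def op_ring_def)
  moreover have "monoid (op_ring R)"
    by (rule monoidI) (auto simp: m_assoc)
  ultimately show ?thesis
    by (intro ringI) (auto simp: l_distr r_distr)
qed

text \<open>Both conventions write the scalar first in \<open>smult\<close>, so reversing the ring
  multiplication turns the right module laws into the left ones, and the two kinds of free module
  become the same record. A dual basis of \<open>U\<^sub>\<lhd>\<close> is thus an instance of the
  one for left modules.\<close>

lemma rprojective_imp_lprojective_op_ring:
  fixes R :: "('r, 'c) ring_scheme" and M :: "('r, 'm) module"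
  assumes "rprojective R M"
  shows "lprojective (op_ring R) M"
proof -
  have free: "free_rmod R I = free_lmod (op_ring R) I" for I :: "'m set"
    by (simp add: free_rmod_def free_lmod_def)
  have hom: "mod_hom R X Y f = mod_hom (op_ring R) X Y f"
    for X :: "('r, 'x) module" and Y :: "('r, 'y) module" and f
    by (simp add: mod_hom_def)
  have "lmodule (op_ring R) M"
    using assms by (simp add: rprojective_def rmodule_def lmodule_def ring_op_ring)
  then show ?thesis
    using assms by (simp add: rprojective_def lprojective_def free hom)
qed

section \<open>Tensor products of modules over a bialgebroid\<close>

lemma tens_eq_free_lift_fun:
  assumes "x \<in> free_ab S" "\<And>a. a \<in> S \<Longrightarrow> tens_eq R M rm N ln (g a) (h a)"
  shows "tens_eq R M rm N ln (free_lift g x) (free_lift h x)"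
  using assms(1)
  by (induction rule: free_ab_induct)
     (auto simp: assms(2) free_lift_fdiff[where S = S] intro: tens_eq_refl tens_eq_fdiff)

lemma tens_eq_fmap2:
  assumes "tens_eq R M rm N ln x y"
    and "abelian_group M'" "abelian_group N'" "additive M M' f" "additive N N' g"
    and "\<And>m r. m \<in> carrier M' \<Longrightarrow> r \<in> carrier R \<Longrightarrow> rm' m r \<in> carrier M'"
    and "\<And>r n. r \<in> carrier R \<Longrightarrow> n \<in> carrier N' \<Longrightarrow> ln' r n \<in> carrier N'"
    and "\<And>m r. m \<in> carrier M \<Longrightarrow> r \<in> carrier R \<Longrightarrow> f (rm m r) = rm' (f m) r"
    and "\<And>r n. r \<in> carrier R \<Longrightarrow> n \<in> carrier N \<Longrightarrow> g (ln r n) = ln' r (g n)"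
  shows "tens_eq R M' rm' N' ln' (fmap2 f g x) (fmap2 f g y)"
  unfolding fmap2_def
  by (rule tens_eq_free_lift[OF assms(1)])
     (use assms additiveD[OF assms(4)] additiveD[OF assms(5)] in
       \<open>auto intro: tens_eq_add_left tens_eq_add_right tens_eq_balance\<close>)

lemma tens_eq_fmap2_add_left:
  assumes "abelian_group M" "z \<in> free_ab (S \<times> T)"
    and "\<And>a. a \<in> S \<Longrightarrow> f a \<in> carrier M" "\<And>a. a \<in> S \<Longrightarrow> f' a \<in> carrier M" "\<And>b. b \<in> T \<Longrightarrow> g b \<in> carrier N"
  shows "tens_eq R M rm N ln (fmap2 (\<lambda>a. f a \<oplus>\<^bsub>M\<^esub> f' a) g z) (fadd (fmap2 f g z) (fmap2 f' g z))"
  unfolding fmap2_def free_lift_add_fun[symmetric]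
  by (rule tens_eq_free_lift_fun[OF assms(2)]) (use assms in \<open>auto intro: tens_eq_add_left\<close>)

lemma tens_eq_fmap2_add_right:
  assumes "abelian_group N" "z \<in> free_ab (S \<times> T)"
    and "\<And>a. a \<in> S \<Longrightarrow> f a \<in> carrier M" "\<And>b. b \<in> T \<Longrightarrow> g b \<in> carrier N" "\<And>b. b \<in> T \<Longrightarrow> g' b \<in> carrier N"
  shows "tens_eq R M rm N ln (fmap2 f (\<lambda>b. g b \<oplus>\<^bsub>N\<^esub> g' b) z) (fadd (fmap2 f g z) (fmap2 f g' z))"
  unfolding fmap2_def free_lift_add_fun[symmetric]
  by (rule tens_eq_free_lift_fun[OF assms(2)]) (use assms in \<open>auto intro: tens_eq_add_right\<close>)

lemma free_lift_fdelta_self: "x \<in> free_ab S \<Longrightarrow> free_lift fdelta x = x"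
  by (induction rule: free_ab_induct) (auto simp: free_lift_fdiff[where S = S])

locale bialgebroid =
  fixes k :: "'k ring" and A :: "'a ring" and U :: "'u ring"
    and iA :: "'k \<Rightarrow> 'a" and iU :: "'k \<Rightarrow> 'u" and s t :: "'a \<Rightarrow> 'u"
    and delta :: "'u \<Rightarrow> 'u \<times> 'u \<Rightarrow> int" and epsh :: "'u \<Rightarrow> 'a \<Rightarrow> 'a"
  assumes bialgebra: "times_bialgebra k A U iA iU s t delta epsh"
begin

lemma Ae: "Ae_algebra k A U iA iU s t"
  using bialgebra by (simp add: times_bialgebra_def)

sublocale A: ring A
  using Ae by (simp add: Ae_algebra_def k_algebra_def)

sublocale U: ring U
  using Ae by (simp add: Ae_algebra_def k_algebra_def)

lemma
  shows s_closed [simp]: "a \<in> carrier A \<Longrightarrow> s a \<in> carrier U"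
    and t_closed [simp]: "a \<in> carrier A \<Longrightarrow> t a \<in> carrier U"
    and s_one [simp]: "s \<one>\<^bsub>A\<^esub> = \<one>\<^bsub>U\<^esub>"
    and t_add: "a \<in> carrier A \<Longrightarrow> b \<in> carrier A \<Longrightarrow> t (a \<oplus>\<^bsub>A\<^esub> b) = t a \<oplus>\<^bsub>U\<^esub> t b"
    and t_mult: "a \<in> carrier A \<Longrightarrow> b \<in> carrier A \<Longrightarrow> t (a \<otimes>\<^bsub>A\<^esub> b) = t b \<otimes>\<^bsub>U\<^esub> t a"
  using Ae by (auto simp: Ae_algebra_def ring_hom_def)

lemma lmodule_U: "lmodule U (reg_mod U)"
  using U.ring_axioms by (rule lmodule_reg_mod)

definition teq where
  "teq P Q = tens_eq A P (\<lambda>p a. t a \<odot>\<^bsub>P\<^esub> p) Q (\<lambda>a q. s a \<odot>\<^bsub>Q\<^esub> q)"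

definition cls where
  "cls P Q x = {y. teq P Q x y}"

text \<open>The diagonal action before passing to classes. It depends on the chosen representative
  \<open>delta u\<close>, which is why its laws in \<open>u\<close> are stated up to
  \<open>teq\<close>, while additivity in the formal sum is exact.\<close>

definition act where
  "act P Q u = free_lift (\<lambda>(p, q). fmap2 (\<lambda>a. a \<odot>\<^bsub>P\<^esub> p) (\<lambda>b. b \<odot>\<^bsub>Q\<^esub> q) (delta u))"

abbreviation ten where
  "ten P Q \<equiv> tensor_mod A s t delta P Q"

abbreviation reps where
  "reps P Q \<equiv> free_ab (carrier P \<times> carrier Q)"

lemma UU_eq_teq: "UU_eq A U s t = teq (reg_mod U) (reg_mod U)"
  by (simp add: UU_eq_def teq_def tens_eq_def tens_rel_def fun_eq_iff)

lemma
  shows delta_closed [simp]: "u \<in> carrier U \<Longrightarrow> delta u \<in> free_ab (carrier U \<times> carrier U)"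
    and delta_Takeuchi: "u \<in> carrier U \<Longrightarrow> a \<in> carrier A \<Longrightarrow>
      teq (reg_mod U) (reg_mod U) (fmap2 (\<lambda>x. x \<otimes>\<^bsub>U\<^esub> t a) (\<lambda>y. y) (delta u))
        (fmap2 (\<lambda>x. x) (\<lambda>y. y \<otimes>\<^bsub>U\<^esub> s a) (delta u))"
    and delta_add: "u \<in> carrier U \<Longrightarrow> v \<in> carrier U \<Longrightarrow>
      teq (reg_mod U) (reg_mod U) (delta (u \<oplus>\<^bsub>U\<^esub> v)) (fadd (delta u) (delta v))"
    and delta_mult: "u \<in> carrier U \<Longrightarrow> v \<in> carrier U \<Longrightarrow>
      teq (reg_mod U) (reg_mod U) (delta (u \<otimes>\<^bsub>U\<^esub> v)) (tmul U (delta u) (delta v))"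
    and delta_one: "teq (reg_mod U) (reg_mod U) (delta \<one>\<^bsub>U\<^esub>) (fdelta (\<one>\<^bsub>U\<^esub>, \<one>\<^bsub>U\<^esub>))"
    and delta_s_t: "a \<in> carrier A \<Longrightarrow> b \<in> carrier A \<Longrightarrow>
      teq (reg_mod U) (reg_mod U) (delta (s a \<otimes>\<^bsub>U\<^esub> t b)) (fdelta (s a, t b))"
  using bialgebra by (simp_all add: times_bialgebra_def UU_eq_teq id_def)

lemma delta_t: "b \<in> carrier A \<Longrightarrow> teq (reg_mod U) (reg_mod U) (delta (t b)) (fdelta (\<one>\<^bsub>U\<^esub>, t b))"
  using delta_s_t[of "\<one>\<^bsub>A\<^esub>" b] by simp

lemma
  shows teq_carrier: "teq P Q x y \<Longrightarrow> x \<in> reps P Q \<and> y \<in> reps P Q"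
    and teq_refl: "x \<in> reps P Q \<Longrightarrow> teq P Q x x"
    and teq_sym: "teq P Q x y \<Longrightarrow> teq P Q y x"
    and teq_trans [trans]: "teq P Q x y \<Longrightarrow> teq P Q y z \<Longrightarrow> teq P Q x z"
    and teq_fadd: "teq P Q x x' \<Longrightarrow> teq P Q y y' \<Longrightarrow> teq P Q (fadd x y) (fadd x' y')"
    and teq_fdiff: "teq P Q x x' \<Longrightarrow> teq P Q y y' \<Longrightarrow> teq P Q (fdiff x y) (fdiff x' y')"
  unfolding teq_def
  by (auto intro: tens_eq_refl tens_eq_sym tens_eq_trans tens_eq_fadd tens_eq_fdiff
        dest: tens_eq_carrier)

lemma teq_free_lift_fun:
  "x \<in> free_ab S \<Longrightarrow> (\<And>a. a \<in> S \<Longrightarrow> teq P Q (g a) (h a)) \<Longrightarrow> teq P Q (free_lift g x) (free_lift h x)"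
  unfolding teq_def by (rule tens_eq_free_lift_fun)

lemma teq_fmap2:
  assumes "teq P Q x y" "lmodule U P" "lmodule U Q" "lmodule U P'" "lmodule U Q'"
    and f: "additive P P' f" "\<And>a p. a \<in> carrier A \<Longrightarrow> p \<in> carrier P \<Longrightarrow> f (t a \<odot>\<^bsub>P\<^esub> p) = t a \<odot>\<^bsub>P'\<^esub> f p"
    and g: "additive Q Q' g" "\<And>a q. a \<in> carrier A \<Longrightarrow> q \<in> carrier Q \<Longrightarrow> g (s a \<odot>\<^bsub>Q\<^esub> q) = s a \<odot>\<^bsub>Q'\<^esub> g q"
  shows "teq P' Q' (fmap2 f g x) (fmap2 f g y)"
  using assms unfolding teq_def
  by (elim tens_eq_fmap2) (auto simp: lmoduleD)

section \<open>The diagonal action on formal sums\<close>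

context
  fixes P :: "('u, 'p) module" and Q :: "('u, 'q) module"
  assumes P: "lmodule U P" and Q: "lmodule U Q"
begin

lemma ev_closed [simp]:
  "z \<in> free_ab (carrier U \<times> carrier U) \<Longrightarrow> p \<in> carrier P \<Longrightarrow> q \<in> carrier Q \<Longrightarrow>
    fmap2 (\<lambda>a. a \<odot>\<^bsub>P\<^esub> p) (\<lambda>b. b \<odot>\<^bsub>Q\<^esub> q) z \<in> reps P Q"
  by (erule fmap2_closed) (auto simp: lmoduleD[OF P] lmoduleD[OF Q])

text \<open>Evaluation at \<open>(p, q)\<close> is the map
  \<open>U \<otimes> U \<rightarrow> P \<otimes> Q\<close> induced by \<open>a \<mapsto> a p\<close>
  and \<open>b \<mapsto> b q\<close>. Through it every law of \<open>delta\<close> becomes a law of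
  the action.\<close>

lemma teq_ev:
  assumes "teq (reg_mod U) (reg_mod U) x y" "p \<in> carrier P" "q \<in> carrier Q"
  shows "teq P Q (fmap2 (\<lambda>a. a \<odot>\<^bsub>P\<^esub> p) (\<lambda>b. b \<odot>\<^bsub>Q\<^esub> q) x)
    (fmap2 (\<lambda>a. a \<odot>\<^bsub>P\<^esub> p) (\<lambda>b. b \<odot>\<^bsub>Q\<^esub> q) y)"
  by (rule teq_fmap2[OF assms(1) lmodule_U lmodule_U P Q])
     (use assms P Q in \<open>auto simp: additive_def lmoduleD\<close>)

lemma act_closed [simp]: "u \<in> carrier U \<Longrightarrow> x \<in> reps P Q \<Longrightarrow> act P Q u x \<in> reps P Q"
  unfolding act_def by (erule free_lift_closed) auto

lemma act_fzero [simp]: "act P Q u fzero = fzero"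
  by (simp add: act_def)

lemma act_fdelta: "act P Q u (fdelta (p, q)) = fmap2 (\<lambda>a. a \<odot>\<^bsub>P\<^esub> p) (\<lambda>b. b \<odot>\<^bsub>Q\<^esub> q) (delta u)"
  by (simp add: act_def)

lemma act_fadd: "x \<in> reps P Q \<Longrightarrow> y \<in> reps P Q \<Longrightarrow> act P Q u (fadd x y) = fadd (act P Q u x) (act P Q u y)"
  unfolding act_def by (rule free_lift_fadd)

lemma act_fdiff: "x \<in> reps P Q \<Longrightarrow> y \<in> reps P Q \<Longrightarrow> act P Q u (fdiff x y) = fdiff (act P Q u x) (act P Q u y)"
  unfolding act_def by (rule free_lift_fdiff)

text \<open>The action descends to the tensor product. Additivity in each factor is formal; the
  balancing relation is where the Takeuchi condition enters, since it trades right multiplication by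
  \<open>t r\<close> on the first leg for right multiplication by \<open>s r\<close> on the
  second.\<close>

lemma act_cong:
  assumes "teq P Q x y" "u \<in> carrier U"
  shows "teq P Q (act P Q u x) (act P Q u y)"
  unfolding act_def teq_def
proof (rule tens_eq_free_lift[OF assms(1)[unfolded teq_def]], unfold split_conv teq_def[symmetric])
  let ?d = "delta u"
  have d: "?d \<in> free_ab (carrier U \<times> carrier U)" using assms by simp
  show "fmap2 (\<lambda>a. a \<odot>\<^bsub>P\<^esub> p) (\<lambda>b. b \<odot>\<^bsub>Q\<^esub> q) ?d \<in> reps P Q" if "p \<in> carrier P" "q \<in> carrier Q" for p q
    using that d by simp
  fix p q assume p: "p \<in> carrier P" and q: "q \<in> carrier Q"
  show "teq P Q (fmap2 (\<lambda>a. a \<odot>\<^bsub>P\<^esub> (p \<oplus>\<^bsub>P\<^esub> p')) (\<lambda>b. b \<odot>\<^bsub>Q\<^esub> q) ?d)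
      (fadd (fmap2 (\<lambda>a. a \<odot>\<^bsub>P\<^esub> p) (\<lambda>b. b \<odot>\<^bsub>Q\<^esub> q) ?d) (fmap2 (\<lambda>a. a \<odot>\<^bsub>P\<^esub> p') (\<lambda>b. b \<odot>\<^bsub>Q\<^esub> q) ?d))"
    if p': "p' \<in> carrier P" for p'
  proof -
    have "fmap2 (\<lambda>a. a \<odot>\<^bsub>P\<^esub> (p \<oplus>\<^bsub>P\<^esub> p')) (\<lambda>b. b \<odot>\<^bsub>Q\<^esub> q) ?d =
        fmap2 (\<lambda>a. a \<odot>\<^bsub>P\<^esub> p \<oplus>\<^bsub>P\<^esub> a \<odot>\<^bsub>P\<^esub> p') (\<lambda>b. b \<odot>\<^bsub>Q\<^esub> q) ?d"
      by (rule fmap2_cong[OF d]) (use p p' P in \<open>auto simp: lmoduleD\<close>)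
    then show ?thesis unfolding teq_def
      using tens_eq_fmap2_add_left[OF lmoduleD(2)[OF P] d, where f = "\<lambda>a. a \<odot>\<^bsub>P\<^esub> p"
          and f' = "\<lambda>a. a \<odot>\<^bsub>P\<^esub> p'" and g = "\<lambda>b. b \<odot>\<^bsub>Q\<^esub> q" and N = Q] p q p' P Q
      by (simp add: lmoduleD)
  qed
  show "teq P Q (fmap2 (\<lambda>a. a \<odot>\<^bsub>P\<^esub> p) (\<lambda>b. b \<odot>\<^bsub>Q\<^esub> (q \<oplus>\<^bsub>Q\<^esub> q')) ?d)
      (fadd (fmap2 (\<lambda>a. a \<odot>\<^bsub>P\<^esub> p) (\<lambda>b. b \<odot>\<^bsub>Q\<^esub> q) ?d) (fmap2 (\<lambda>a. a \<odot>\<^bsub>P\<^esub> p) (\<lambda>b. b \<odot>\<^bsub>Q\<^esub> q') ?d))"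
    if q': "q' \<in> carrier Q" for q'
  proof -
    have "fmap2 (\<lambda>a. a \<odot>\<^bsub>P\<^esub> p) (\<lambda>b. b \<odot>\<^bsub>Q\<^esub> (q \<oplus>\<^bsub>Q\<^esub> q')) ?d =
        fmap2 (\<lambda>a. a \<odot>\<^bsub>P\<^esub> p) (\<lambda>b. b \<odot>\<^bsub>Q\<^esub> q \<oplus>\<^bsub>Q\<^esub> b \<odot>\<^bsub>Q\<^esub> q') ?d"
      by (rule fmap2_cong[OF d]) (use q q' Q in \<open>auto simp: lmoduleD\<close>)
    then show ?thesis unfolding teq_def
      using tens_eq_fmap2_add_right[OF lmoduleD(2)[OF Q] d, where f = "\<lambda>a. a \<odot>\<^bsub>P\<^esub> p"
          and g = "\<lambda>b. b \<odot>\<^bsub>Q\<^esub> q" and g' = "\<lambda>b. b \<odot>\<^bsub>Q\<^esub> q'" and M = P] p q q' P Q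
      by (simp add: lmoduleD)
  qed
  show "teq P Q (fmap2 (\<lambda>a. a \<odot>\<^bsub>P\<^esub> (t r \<odot>\<^bsub>P\<^esub> p)) (\<lambda>b. b \<odot>\<^bsub>Q\<^esub> q) ?d)
      (fmap2 (\<lambda>a. a \<odot>\<^bsub>P\<^esub> p) (\<lambda>b. b \<odot>\<^bsub>Q\<^esub> (s r \<odot>\<^bsub>Q\<^esub> q)) ?d)"
    if r: "r \<in> carrier A" for r
  proof -
    have "fmap2 (\<lambda>a. a \<odot>\<^bsub>P\<^esub> (t r \<odot>\<^bsub>P\<^esub> p)) (\<lambda>b. b \<odot>\<^bsub>Q\<^esub> q) ?d =
        fmap2 (\<lambda>a. a \<odot>\<^bsub>P\<^esub> p) (\<lambda>b. b \<odot>\<^bsub>Q\<^esub> q) (fmap2 (\<lambda>x. x \<otimes>\<^bsub>U\<^esub> t r) (\<lambda>y. y) ?d)"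
      unfolding fmap2_fmap2[OF d] by (rule fmap2_cong[OF d]) (use p r P in \<open>auto simp: lmoduleD\<close>)
    moreover have "fmap2 (\<lambda>a. a \<odot>\<^bsub>P\<^esub> p) (\<lambda>b. b \<odot>\<^bsub>Q\<^esub> (s r \<odot>\<^bsub>Q\<^esub> q)) ?d =
        fmap2 (\<lambda>a. a \<odot>\<^bsub>P\<^esub> p) (\<lambda>b. b \<odot>\<^bsub>Q\<^esub> q) (fmap2 (\<lambda>x. x) (\<lambda>y. y \<otimes>\<^bsub>U\<^esub> s r) ?d)"
      unfolding fmap2_fmap2[OF d] by (rule fmap2_cong[OF d]) (use q r Q in \<open>auto simp: lmoduleD\<close>)
    ultimately show ?thesis
      using teq_ev[OF delta_Takeuchi[OF assms(2) r] p q] by simp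
  qed
qed

lemma act_add:
  assumes "u \<in> carrier U" "v \<in> carrier U" "x \<in> reps P Q"
  shows "teq P Q (act P Q (u \<oplus>\<^bsub>U\<^esub> v) x) (fadd (act P Q u x) (act P Q v x))"
  unfolding act_def free_lift_add_fun[symmetric]
proof (rule teq_free_lift_fun[OF assms(3)], clarify)
  fix p q assume "p \<in> carrier P" "q \<in> carrier Q"
  then show "teq P Q (fmap2 (\<lambda>a. a \<odot>\<^bsub>P\<^esub> p) (\<lambda>b. b \<odot>\<^bsub>Q\<^esub> q) (delta (u \<oplus>\<^bsub>U\<^esub> v)))
     (fadd (fmap2 (\<lambda>a. a \<odot>\<^bsub>P\<^esub> p) (\<lambda>b. b \<odot>\<^bsub>Q\<^esub> q) (delta u))
       (fmap2 (\<lambda>a. a \<odot>\<^bsub>P\<^esub> p) (\<lambda>b. b \<odot>\<^bsub>Q\<^esub> q) (delta v)))"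
    using teq_ev[OF delta_add[OF assms(1,2)]] assms
    by (simp add: fmap2_fadd[where S = "carrier U \<times> carrier U"])
qed

text \<open>\<open>tmul\<close> sums over its left argument on the outside, whereas in an iterated
  action the inner element is expanded first. The interchange of finite sums reconciles the two
  orders.\<close>

lemma ev_tmul:
  assumes "x \<in> free_ab (carrier U \<times> carrier U)" "y \<in> free_ab (carrier U \<times> carrier U)"
    "p \<in> carrier P" "q \<in> carrier Q"
  shows "fmap2 (\<lambda>a. a \<odot>\<^bsub>P\<^esub> p) (\<lambda>b. b \<odot>\<^bsub>Q\<^esub> q) (tmul U x y) =
    free_lift (\<lambda>(c, d). fmap2 (\<lambda>a. a \<odot>\<^bsub>P\<^esub> (c \<odot>\<^bsub>P\<^esub> p)) (\<lambda>b. b \<odot>\<^bsub>Q\<^esub> (d \<odot>\<^bsub>Q\<^esub> q)) x) y"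
proof -
  let ?S = "carrier U \<times> carrier U"
  have "fmap2 (\<lambda>a. a \<odot>\<^bsub>P\<^esub> p) (\<lambda>b. b \<odot>\<^bsub>Q\<^esub> q) (tmul U x y) =
      free_lift (\<lambda>e. free_lift (\<lambda>f. fdelta ((fst e \<otimes>\<^bsub>U\<^esub> fst f) \<odot>\<^bsub>P\<^esub> p, (snd e \<otimes>\<^bsub>U\<^esub> snd f) \<odot>\<^bsub>Q\<^esub> q)) y) x"
    unfolding tmul_def split_def
    by (subst fmap2_free_lift[OF assms(1), where T = ?S])
       (use assms in \<open>auto intro!: free_lift_closed[where S = ?S] free_lift_cong[where S = ?S]
          simp: fmap2_free_lift[where S = ?S and T = UNIV]\<close>)
  also have "\<dots> = free_lift (\<lambda>f. free_lift (\<lambda>e. fdelta ((fst e \<otimes>\<^bsub>U\<^esub> fst f) \<odot>\<^bsub>P\<^esub> p, (snd e \<otimes>\<^bsub>U\<^esub> snd f) \<odot>\<^bsub>Q\<^esub> q)) x) y"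
    by (rule free_lift_swap[OF assms(1,2)])
  also have "\<dots> = free_lift (\<lambda>(c, d). fmap2 (\<lambda>a. a \<odot>\<^bsub>P\<^esub> (c \<odot>\<^bsub>P\<^esub> p)) (\<lambda>b. b \<odot>\<^bsub>Q\<^esub> (d \<odot>\<^bsub>Q\<^esub> q)) x) y"
    unfolding fmap2_def split_def
    by (intro free_lift_cong[OF assms(2)] free_lift_cong[OF assms(1)])
       (use assms P Q in \<open>auto simp: lmoduleD\<close>)
  finally show ?thesis .
qed

lemma act_mult:
  assumes "u \<in> carrier U" "v \<in> carrier U" "x \<in> reps P Q"
  shows "teq P Q (act P Q (u \<otimes>\<^bsub>U\<^esub> v) x) (act P Q u (act P Q v x))"
proof -
  have "act P Q u (act P Q v x) =
      free_lift (\<lambda>(p, q). act P Q u (fmap2 (\<lambda>a. a \<odot>\<^bsub>P\<^esub> p) (\<lambda>b. b \<odot>\<^bsub>Q\<^esub> q) (delta v))) x"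
    unfolding act_def[of P Q v] act_def[of P Q u]
    by (subst free_lift_free_lift[OF assms(3), where T = "carrier P \<times> carrier Q"])
       (use assms in \<open>auto simp: split_def\<close>)
  moreover have "teq P Q (act P Q (u \<otimes>\<^bsub>U\<^esub> v) x) \<dots>"
    unfolding act_def[of P Q "u \<otimes>\<^bsub>U\<^esub> v"]
  proof (rule teq_free_lift_fun[OF assms(3)], clarify)
    fix p q assume p: "p \<in> carrier P" and q: "q \<in> carrier Q"
    \<comment> \<open>On a pure tensor the iterated action is exactly the evaluation of
      \<open>tmul\<close>; the relations are used only to pass from there to \<open>delta\<close> of
      the product.\<close>
    have "act P Q u (fmap2 (\<lambda>a. a \<odot>\<^bsub>P\<^esub> p) (\<lambda>b. b \<odot>\<^bsub>Q\<^esub> q) (delta v)) =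
        fmap2 (\<lambda>a. a \<odot>\<^bsub>P\<^esub> p) (\<lambda>b. b \<odot>\<^bsub>Q\<^esub> q) (tmul U (delta u) (delta v))"
      unfolding act_def
      by (simp add: ev_tmul assms p q free_lift_fmap2[where S = "carrier U \<times> carrier U"])
    then show "teq P Q (fmap2 (\<lambda>a. a \<odot>\<^bsub>P\<^esub> p) (\<lambda>b. b \<odot>\<^bsub>Q\<^esub> q) (delta (u \<otimes>\<^bsub>U\<^esub> v)))
      (act P Q u (fmap2 (\<lambda>a. a \<odot>\<^bsub>P\<^esub> p) (\<lambda>b. b \<odot>\<^bsub>Q\<^esub> q) (delta v)))"
      using teq_ev[OF delta_mult[OF assms(1,2)] p q] by simp
  qed
  ultimately show ?thesis by simp
qed

lemma act_one:
  assumes "x \<in> reps P Q"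
  shows "teq P Q (act P Q \<one>\<^bsub>U\<^esub> x) x"
proof -
  \<comment> \<open>Writing \<open>x\<close> as a linear extension of \<open>fdelta\<close> allows
    the two sides to be compared on generators.\<close>
  have "teq P Q (act P Q \<one>\<^bsub>U\<^esub> x) (free_lift fdelta x)"
    unfolding act_def
  proof (rule teq_free_lift_fun[OF assms], clarify)
    fix p q assume "p \<in> carrier P" "q \<in> carrier Q"
    then show "teq P Q (fmap2 (\<lambda>a. a \<odot>\<^bsub>P\<^esub> p) (\<lambda>b. b \<odot>\<^bsub>Q\<^esub> q) (delta \<one>\<^bsub>U\<^esub>)) (fdelta (p, q))"
      using teq_ev[OF delta_one, of p q] P Q by (simp add: lmoduleD)
  qed
  then show ?thesis using free_lift_fdelta_self[OF assms] by simp
qed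

section \<open>The tensor product as a left module\<close>

lemma cls_eq_iff: "x \<in> reps P Q \<Longrightarrow> y \<in> reps P Q \<Longrightarrow> cls P Q x = cls P Q y \<longleftrightarrow> teq P Q x y"
  unfolding cls_def by (auto intro: teq_refl teq_sym teq_trans)

text \<open>The operations of \<open>tensor_mod\<close> pick representatives by \<open>SOME\<close>.
  Since the picked element is equivalent to the given one, the operations can be computed on any
  representative.\<close>

lemma teq_rep: "x \<in> reps P Q \<Longrightarrow> teq P Q x (SOME y. y \<in> cls P Q x)"
  using someI[of "\<lambda>y. y \<in> cls P Q x" x] by (simp add: cls_def teq_refl)

lemma ten_carrier: "carrier (ten P Q) = cls P Q ` reps P Q"
  by (simp add: tensor_mod_def Let_def cls_def teq_def)

lemma cls_closed [simp]: "x \<in> reps P Q \<Longrightarrow> cls P Q x \<in> carrier (ten P Q)"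
  by (simp add: ten_carrier)

lemma ten_zero: "\<zero>\<^bsub>ten P Q\<^esub> = cls P Q fzero"
  by (simp add: tensor_mod_def Let_def cls_def teq_def)

lemma ten_add:
  assumes "x \<in> reps P Q" "y \<in> reps P Q"
  shows "cls P Q x \<oplus>\<^bsub>ten P Q\<^esub> cls P Q y = cls P Q (fadd x y)"
proof -
  have "cls P Q x \<oplus>\<^bsub>ten P Q\<^esub> cls P Q y =
      cls P Q (fadd (SOME z. z \<in> cls P Q x) (SOME z. z \<in> cls P Q y))"
    by (simp add: tensor_mod_def Let_def cls_def teq_def)
  also have "\<dots> = cls P Q (fadd x y)"
    using teq_fadd[OF teq_rep[OF assms(1)] teq_rep[OF assms(2)]]
    by (metis cls_eq_iff teq_carrier)
  finally show ?thesis .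
qed

lemma ten_smult:
  assumes "u \<in> carrier U" "x \<in> reps P Q"
  shows "u \<odot>\<^bsub>ten P Q\<^esub> cls P Q x = cls P Q (act P Q u x)"
proof -
  have "u \<odot>\<^bsub>ten P Q\<^esub> cls P Q x = cls P Q (act P Q u (SOME z. z \<in> cls P Q x))"
    by (simp add: tensor_mod_def Let_def cls_def teq_def act_def fmap2_def)
  also have "\<dots> = cls P Q (act P Q u x)"
    using act_cong[OF teq_rep[OF assms(2)] assms(1)] by (metis cls_eq_iff teq_carrier)
  finally show ?thesis .
qed

lemma abelian_group_ten: "abelian_group (ten P Q)"
proof (rule abelian_groupI)
  have "\<exists>y\<in>carrier (ten P Q). y \<oplus>\<^bsub>ten P Q\<^esub> cls P Q x = \<zero>\<^bsub>ten P Q\<^esub>" if "x \<in> reps P Q" for x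
    by (rule bexI[of _ "cls P Q (fdiff fzero x)"]) (simp_all add: that ten_add ten_zero)
  then show "\<exists>y\<in>carrier (ten P Q). y \<oplus>\<^bsub>ten P Q\<^esub> X = \<zero>\<^bsub>ten P Q\<^esub>" if "X \<in> carrier (ten P Q)" for X
    using that by (auto simp: ten_carrier)
  show "X \<oplus>\<^bsub>ten P Q\<^esub> Y = Y \<oplus>\<^bsub>ten P Q\<^esub> X" if "X \<in> carrier (ten P Q)" "Y \<in> carrier (ten P Q)" for X Y
  proof -
    obtain x y where "x \<in> reps P Q" "y \<in> reps P Q" "X = cls P Q x" "Y = cls P Q y"
      using \<open>X \<in> _\<close> \<open>Y \<in> _\<close> by (auto simp: ten_carrier)
    then show ?thesis using fadd_commute[of x y] by (simp add: ten_add)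
  qed
qed (auto simp: ten_carrier ten_add ten_zero fadd_assoc)

lemma ten_diff:
  assumes "x \<in> reps P Q" "y \<in> reps P Q"
  shows "cls P Q x \<ominus>\<^bsub>ten P Q\<^esub> cls P Q y = cls P Q (fdiff x y)"
proof -
  interpret abelian_group "ten P Q" by (rule abelian_group_ten)
  show ?thesis
    by (rule minus_eq_if_add_eq) (use assms in \<open>simp_all add: ten_add\<close>)
qed

lemma lmodule_ten: "lmodule U (ten P Q)"
  unfolding lmodule_def
proof (intro conjI ballI)
  fix u v X assume u: "u \<in> carrier U" and v: "v \<in> carrier U" and "X \<in> carrier (ten P Q)"
  then obtain x where x: "x \<in> reps P Q" "X = cls P Q x" by (auto simp: ten_carrier)
  show "(u \<oplus>\<^bsub>U\<^esub> v) \<odot>\<^bsub>ten P Q\<^esub> X = u \<odot>\<^bsub>ten P Q\<^esub> X \<oplus>\<^bsub>ten P Q\<^esub> v \<odot>\<^bsub>ten P Q\<^esub> X"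
    using u v x by (simp add: ten_smult ten_add cls_eq_iff act_add)
  show "(u \<otimes>\<^bsub>U\<^esub> v) \<odot>\<^bsub>ten P Q\<^esub> X = u \<odot>\<^bsub>ten P Q\<^esub> (v \<odot>\<^bsub>ten P Q\<^esub> X)"
    using u v x by (simp add: ten_smult cls_eq_iff act_mult)
qed (auto simp: U.ring_axioms abelian_group_ten ten_carrier ten_smult ten_add act_fadd
       cls_eq_iff[THEN iffD2, OF _ _ act_one])

lemma additive_pure_left: "q \<in> carrier Q \<Longrightarrow> additive P (ten P Q) (\<lambda>p. cls P Q (fdelta (p, q)))"
  using lmoduleD(2)[OF P]
  by (simp add: additive_def ten_add cls_eq_iff teq_def tens_eq_add_left abelian_groupE)

lemma additive_pure_right: "p \<in> carrier P \<Longrightarrow> additive Q (ten P Q) (\<lambda>q. cls P Q (fdelta (p, q)))"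
  using lmoduleD(2)[OF Q]
  by (simp add: additive_def ten_add cls_eq_iff teq_def tens_eq_add_right abelian_groupE)

end

section \<open>Functoriality and splittings of tensor products\<close>

definition tmap where
  "tmap P' Q' f g X = cls P' Q' (fmap2 f g (SOME x. x \<in> X))"

context
  fixes P :: "('u, 'p) module" and Q :: "('u, 'q) module"
    and P' :: "('u, 'p2) module" and Q' :: "('u, 'q2) module"
  assumes P: "lmodule U P" and Q: "lmodule U Q" and P': "lmodule U P'" and Q': "lmodule U Q'"
begin

context
  fixes f g
  assumes f: "mod_hom U P P' f" and g: "mod_hom U Q Q' g"
begin

lemma fmap2_hom_closed: "x \<in> reps P Q \<Longrightarrow> fmap2 f g x \<in> reps P' Q'"
  by (erule fmap2_closed) (use f g in \<open>auto simp: mod_hom_def\<close>)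

lemma tmap_cls:
  assumes "x \<in> reps P Q"
  shows "tmap P' Q' f g (cls P Q x) = cls P' Q' (fmap2 f g x)"
proof -
  let ?y = "SOME y. y \<in> cls P Q x"
  have y: "teq P Q x ?y" by (rule teq_rep[OF P Q assms])
  have "teq P' Q' (fmap2 f g x) (fmap2 f g ?y)"
    by (rule teq_fmap2[OF y P Q P' Q']) (use f g in \<open>auto simp: mod_hom_def additive_def\<close>)
  then show ?thesis
    unfolding tmap_def using cls_eq_iff[OF P' Q'] teq_carrier by metis
qed

text \<open>An equation of formal sums and not only of classes: both sides use the same
  representative \<open>delta u\<close>, and \<open>f\<close> and \<open>g\<close> commute with its
  legs one by one.\<close>

lemma fmap2_act:
  assumes "u \<in> carrier U" "x \<in> reps P Q"
  shows "fmap2 f g (act P Q u x) = act P' Q' u (fmap2 f g x)"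
proof -
  let ?S = "carrier U \<times> carrier U"
  have d: "delta u \<in> free_ab ?S" using assms by simp
  have "fmap2 f g (act P Q u x) =
      free_lift (\<lambda>(p, q). fmap2 (\<lambda>a. f (a \<odot>\<^bsub>P\<^esub> p)) (\<lambda>b. g (b \<odot>\<^bsub>Q\<^esub> q)) (delta u)) x"
    unfolding act_def
    by (subst fmap2_free_lift[OF assms(2), where T = "carrier P \<times> carrier Q"])
       (use d P Q in \<open>auto simp: split_def fmap2_fmap2[OF d]\<close>)
  also have "\<dots> = free_lift (\<lambda>(p, q). fmap2 (\<lambda>a. a \<odot>\<^bsub>P'\<^esub> f p) (\<lambda>b. b \<odot>\<^bsub>Q'\<^esub> g q) (delta u)) x"
    by (rule free_lift_cong[OF assms(2)])
       (use f g in \<open>auto simp: mod_hom_def intro!: fmap2_cong[OF d]\<close>)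
  also have "\<dots> = act P' Q' u (fmap2 f g x)"
    unfolding act_def free_lift_fmap2[OF assms(2)] by simp
  finally show ?thesis .
qed

lemma mod_hom_tmap: "mod_hom U (ten P Q) (ten P' Q') (tmap P' Q' f g)"
  unfolding mod_hom_def
  by (auto simp: ten_carrier[OF P Q] tmap_cls fmap2_hom_closed P' Q' P Q ten_add ten_smult fmap2_act
      fmap2_fadd[where S = "carrier P \<times> carrier Q"] intro: cls_closed[OF P' Q'])

end

end

text \<open>Tensoring two retracts gives a retract. On a pure tensor the two expansions multiply out
  by biadditivity over \<open>K \<times> L\<close>, and outside that set one leg of
  \<open>a j p \<otimes> c k q\<close> is zero. Other elements are differences of such, to which
  \<open>decomposes_at_diff\<close> applies.\<close>

lemma decomposes_through_ten:
  assumes P: "lmodule U P" and P': "lmodule U P'" and Q: "lmodule U Q" and Q': "lmodule U Q'"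
    and decP: "decomposes_through U P P' J a b" and decQ: "decomposes_through U Q Q' J' c d"
  shows "decomposes_through U (ten P Q) (ten P' Q') (J \<times> J')
    (\<lambda>(j, k). tmap P' Q' (a j) (c k)) (\<lambda>(j, k). tmap P Q (b j) (d k))"
proof -
  let ?a = "\<lambda>(j, k). tmap P' Q' (a j) (c k)" and ?b = "\<lambda>(j, k). tmap P Q (b j) (d k)"
  note grp = abelian_group_ten[OF P Q] abelian_group_ten[OF P' Q']
  have homP: "mod_hom U P P' (a j)" "mod_hom U P' P (b j)" if "j \<in> J" for j
    using decP that by (auto simp: decomposes_through_def)
  have homQ: "mod_hom U Q Q' (c k)" "mod_hom U Q' Q (d k)" if "k \<in> J'" for k
    using decQ that by (auto simp: decomposes_through_def)
  have thom: "mod_hom U (ten P Q) (ten P' Q') (?a i)" "mod_hom U (ten P' Q') (ten P Q) (?b i)"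
    if "i \<in> J \<times> J'" for i
    using that by (auto intro!: mod_hom_tmap P P' Q Q' homP homQ)
  have tadd: "additive (ten P Q) (ten P' Q') (?a i)" "additive (ten P' Q') (ten P Q) (?b i)"
    if "i \<in> J \<times> J'" for i
    by (rule mod_hom_additive[OF thom(1)[OF that]], rule mod_hom_additive[OF thom(2)[OF that]])
  have "decomposes_at (ten P Q) (ten P' Q') (J \<times> J') ?a ?b (cls P Q x)" if "x \<in> reps P Q" for x
    using that
  proof (induction rule: free_ab_induct)
    case zero
    show ?case
      unfolding ten_zero[OF P Q, symmetric]
      by (rule decomposes_at_zero[OF grp tadd(1)])
  next
    case (diff x y)
    show ?case
      unfolding ten_diff[OF P Q diff.hyps, symmetric]
      by (rule decomposes_at_diff[OF grp tadd _ _ diff.IH]) (simp_all only: cls_closed[OF P Q] diff.hyps)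
  next
    case (delta z)
    then obtain p q where z: "z = (p, q)" and p: "p \<in> carrier P" and q: "q \<in> carrier Q" by auto
    obtain K where K: "finite K" "K \<subseteq> J" "\<forall>j\<in>J - K. a j p = \<zero>\<^bsub>P'\<^esub>"
        "p = finsum P (\<lambda>j. b j (a j p)) K"
      using decP p unfolding decomposes_through_def decomposes_at_def by blast
    obtain L where L: "finite L" "L \<subseteq> J'" "\<forall>k\<in>J' - L. c k q = \<zero>\<^bsub>Q'\<^esub>"
        "q = finsum Q (\<lambda>k. d k (c k q)) L"
      using decQ q unfolding decomposes_through_def decomposes_at_def by blast
    have ap: "a j p \<in> carrier P'" "b j (a j p) \<in> carrier P" if "j \<in> J" for j
      using homP[OF that] p by (auto simp: mod_hom_def)
    have cq: "c k q \<in> carrier Q'" "d k (c k q) \<in> carrier Q" if "k \<in> J'" for k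
      using homQ[OF that] q by (auto simp: mod_hom_def)
    have ta: "tmap P' Q' (a j) (c k) (cls P Q (fdelta (p, q))) = cls P' Q' (fdelta (a j p, c k q))"
      if "j \<in> J" "k \<in> J'" for j k
      using tmap_cls[OF P Q P' Q' homP(1) homQ(1)] that p q by simp
    have tb: "tmap P Q (b j) (d k) (cls P' Q' (fdelta (a j p, c k q))) = cls P Q (fdelta (b j (a j p), d k (c k q)))"
      if "j \<in> J" "k \<in> J'" for j k
      using tmap_cls[OF P' Q' P Q homP(2) homQ(2)] that ap cq by simp
    interpret T: abelian_group "ten P Q" by (rule grp)
    have cl: "cls P Q (fdelta (b j (a j p), y)) \<in> carrier (ten P Q)" if "j \<in> K" "y \<in> carrier Q" for j y
      using that K(2) ap by (auto intro!: cls_closed[OF P Q])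
    have inner: "cls P Q (fdelta (x, q)) = finsum (ten P Q) (\<lambda>k. cls P Q (fdelta (x, d k (c k q)))) L"
      if "x \<in> carrier P" for x
      by (subst L(4), rule additive_finsum[OF lmoduleD(2)[OF Q] grp(1) additive_pure_right[OF P Q that] L(1)])
         (use L(2) cq in auto)
    have "cls P Q (fdelta (p, q)) = finsum (ten P Q) (\<lambda>j. cls P Q (fdelta (b j (a j p), q))) K"
      by (subst K(4), rule additive_finsum[OF lmoduleD(2)[OF P] grp(1) additive_pure_left[OF P Q q] K(1)])
         (use K(2) ap in auto)
    also have "\<dots> = finsum (ten P Q)
        (\<lambda>j. finsum (ten P Q) (\<lambda>k. cls P Q (fdelta (b j (a j p), d k (c k q)))) L) K"
      by (rule T.finsum_cong') (use K(2) L(2) ap cq cl inner in \<open>auto intro!: T.finsum_closed\<close>)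
    also have "\<dots> = finsum (ten P Q)
        (\<lambda>(j, k). cls P Q (fdelta (b j (a j p), d k (c k q)))) (K \<times> L)"
      by (subst T.finsum_Sigma) (use K(1) L(1,2) cl cq in auto)
    also have "\<dots> = finsum (ten P Q) (\<lambda>i. ?b i (?a i (cls P Q (fdelta (p, q))))) (K \<times> L)"
    proof (rule T.finsum_cong'[OF refl])
      have *: "?b i (?a i (cls P Q (fdelta (p, q)))) =
          (case i of (j, k) \<Rightarrow> cls P Q (fdelta (b j (a j p), d k (c k q))))" if "i \<in> K \<times> L" for i
      proof -
        obtain j k where "i = (j, k)" "j \<in> J" "k \<in> J'" using \<open>i \<in> K \<times> L\<close> K(2) L(2) by auto
        then show ?thesis by (simp add: ta tb)
      qed
      then show "(case i of (j, k) \<Rightarrow> cls P Q (fdelta (b j (a j p), d k (c k q)))) =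
          ?b i (?a i (cls P Q (fdelta (p, q))))" if "i \<in> K \<times> L" for i
        using that by simp
      show "(\<lambda>i. ?b i (?a i (cls P Q (fdelta (p, q))))) \<in> K \<times> L \<rightarrow> carrier (ten P Q)"
        using * cl cq L(2) by (auto simp: subset_iff)
    qed
    finally have "cls P Q (fdelta (p, q)) =
        finsum (ten P Q) (\<lambda>i. ?b i (?a i (cls P Q (fdelta (p, q))))) (K \<times> L)" .
    moreover have "?a i (cls P Q (fdelta (p, q))) = \<zero>\<^bsub>ten P' Q'\<^esub>" if "i \<in> J \<times> J' - K \<times> L" for i
    proof -
      obtain j k where i: "i = (j, k)" "j \<in> J" "k \<in> J'" "j \<notin> K \<or> k \<notin> L"
        using \<open>i \<in> J \<times> J' - K \<times> L\<close> by auto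
      have "cls P' Q' (fdelta (a j p, c k q)) = \<zero>\<^bsub>ten P' Q'\<^esub>"
      proof (cases "j \<in> K")
        case True
        then have "c k q = \<zero>\<^bsub>Q'\<^esub>" using i L(3) by simp
        then show ?thesis
          using additive_zero[OF lmoduleD(2)[OF Q'] grp(2) additive_pure_right[OF P' Q' ap(1)[OF i(2)]]] by simp
      next
        case False
        then have "a j p = \<zero>\<^bsub>P'\<^esub>" using i K(3) by simp
        then show ?thesis
          using additive_zero[OF lmoduleD(2)[OF P'] grp(2) additive_pure_left[OF P' Q' cq(1)[OF i(3)]]] by simp
      qed
      then show ?thesis unfolding i(1) using ta[OF i(2,3)] by simp
    qed
    moreover have "finite (K \<times> L)" "K \<times> L \<subseteq> J \<times> J'" using K L by auto
    ultimately show ?case unfolding z decomposes_at_def by blast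
  qed
  then show ?thesis using thom unfolding decomposes_through_def ten_carrier[OF P Q] by blast
qed

section \<open>The Galois map\<close>

abbreviation "UU \<equiv> ten (reg_mod U) (reg_mod U)"
abbreviation "UUcls \<equiv> cls (reg_mod U) (reg_mod U)"

abbreviation gal where
  "gal \<equiv> galois_rep U delta"

lemma gal_closed:
  "z \<in> reps U U \<Longrightarrow> gal z \<in> reps U U"
  unfolding galois_rep_def
  by (erule free_lift_closed) (auto intro!: free_lift_closed[where S = "carrier U \<times> carrier U"])

lemma gal_fdiff: "x \<in> reps U U \<Longrightarrow> y \<in> reps U U \<Longrightarrow> gal (fdiff x y) = fdiff (gal x) (gal y)"
  unfolding galois_rep_def by (rule free_lift_fdiff)

lemma gal_fadd: "x \<in> reps U U \<Longrightarrow> y \<in> reps U U \<Longrightarrow> gal (fadd x y) = fadd (gal x) (gal y)"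
  unfolding galois_rep_def by (rule free_lift_fadd)

lemma gal_fzero [simp]: "gal fzero = fzero"
  by (simp add: galois_rep_def)

text \<open>Acting diagonally on \<open>1 \<otimes> v\<close> leaves the first leg of
  \<open>delta u\<close> unchanged and multiplies the second by \<open>v\<close>, which is the
  Galois formula. Linearity of the Galois map is thereby reduced to associativity of the
  action.\<close>

lemma gal_fdelta:
  assumes "u \<in> carrier U" "v \<in> carrier U"
  shows "gal (fdelta (u, v)) = act (reg_mod U) (reg_mod U) u (fdelta (\<one>\<^bsub>U\<^esub>, v))"
  unfolding act_fdelta[OF lmodule_U lmodule_U] galois_rep_def free_lift_fdelta split_conv reg_mod_simps
    fmap2_def
  by (rule free_lift_cong[OF delta_closed[OF assms(1)]]) auto

text \<open>On a generator \<open>a \<otimes> b\<close> this is associativity of the diagonal action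
  at \<open>1 \<otimes> b\<close>, which holds modulo the relations because \<open>delta\<close> is
  multiplicative only modulo them.\<close>

lemma gal_mult_left:
  assumes "u \<in> carrier U" "z \<in> reps U U"
  shows "teq (reg_mod U) (reg_mod U) (gal (fmap2 (\<lambda>x. u \<otimes>\<^bsub>U\<^esub> x) (\<lambda>y. y) z))
    (act (reg_mod U) (reg_mod U) u (gal z))"
  using assms(2)
proof (induction rule: free_ab_induct)
  case zero
  show ?case by (simp add: act_fzero[OF lmodule_U lmodule_U] teq_refl)
next
  case (delta x)
  then obtain a b where x: "x = (a, b)" "a \<in> carrier U" "b \<in> carrier U" by auto
  then show ?case
    using act_mult[OF lmodule_U lmodule_U assms(1) x(2), of "fdelta (\<one>\<^bsub>U\<^esub>, b)"] assms(1)
    by (simp add: gal_fdelta)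
next
  case (diff x y)
  have c: "fmap2 (\<lambda>x. u \<otimes>\<^bsub>U\<^esub> x) (\<lambda>y. y) w \<in> reps U U" if "w \<in> reps U U" for w
    using that by (rule fmap2_closed) (use assms in auto)
  show ?case
    using teq_fdiff[OF diff.IH] diff.hyps gal_closed
    by (simp add: fmap2_fdiff[OF diff.hyps] gal_fdiff c act_fdiff[OF lmodule_U lmodule_U])
qed

text \<open>Because \<open>delta (t a)\<close> represents \<open>1 \<otimes> t a\<close>, scalars
  from \<open>A\<close> acting through \<open>t\<close> can be pulled out of the second leg. This
  turns an expansion of \<open>v\<close> over \<open>A\<close> into an expansion of
  \<open>1 \<otimes> v\<close> over \<open>U\<close>.\<close>

lemma smult_t_pure:
  assumes "a \<in> carrier A" "v \<in> carrier U"
  shows "t a \<odot>\<^bsub>UU\<^esub> UUcls (fdelta (\<one>\<^bsub>U\<^esub>, v)) = UUcls (fdelta (\<one>\<^bsub>U\<^esub>, t a \<otimes>\<^bsub>U\<^esub> v))"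
proof -
  have "teq (reg_mod U) (reg_mod U) (act (reg_mod U) (reg_mod U) (t a) (fdelta (\<one>\<^bsub>U\<^esub>, v)))
      (fdelta (\<one>\<^bsub>U\<^esub>, t a \<otimes>\<^bsub>U\<^esub> v))"
    using teq_ev[OF lmodule_U lmodule_U delta_t[OF assms(1)], of "\<one>\<^bsub>U\<^esub>" v] assms
    by (simp add: act_fdelta[OF lmodule_U lmodule_U])
  then show ?thesis using assms
    by (simp add: ten_smult[OF lmodule_U lmodule_U] cls_eq_iff[OF lmodule_U lmodule_U]
        act_closed[OF lmodule_U lmodule_U, unfolded reg_mod_simps])
qed

text \<open>Surjectivity of the Galois map presents every class as the image of a formal sum, so all
  verifications happen on the source; injectivity makes the outcome independent of that formal
  sum.\<close>

lemma decomposes_through_UU: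
  assumes hopf: "times_hopf k A U iA iU s t delta epsh"
    and dec: "decomposes_through (op_ring A) (U_rtri A U t) (reg_mod (op_ring A)) K \<phi> c"
  obtains h b where "decomposes_through U UU (reg_mod U) K h b"
proof -
  note reg = lmodule_U lmodule_U
  let ?V = "U_rtri A U t"
  have V [simp]: "carrier ?V = carrier U" "\<And>x y. x \<oplus>\<^bsub>?V\<^esub> y = x \<oplus>\<^bsub>U\<^esub> y" "\<And>a x. a \<odot>\<^bsub>?V\<^esub> x = t a \<otimes>\<^bsub>U\<^esub> x"
    by (simp_all add: U_rtri_def)
  have grpV: "abelian_group ?V"
    by (rule abelian_groupI)
       (auto simp: U_rtri_def U.a_assoc intro: U.a_comm U.l_neg bexI[of _ "\<ominus>\<^bsub>U\<^esub> _"])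
  have grp: "abelian_group UU" "abelian_group (reg_mod U)"
    by (rule abelian_group_ten[OF reg], rule lmoduleD(2)[OF lmodule_U])
  interpret T: abelian_group UU by fact
  have inj: "UopU_eq A U t z z'"
    if "z \<in> reps U U" "z' \<in> reps U U" "teq (reg_mod U) (reg_mod U) (gal z) (gal z')" for z z'
    using hopf that unfolding times_hopf_def UU_eq_teq by blast
  have surj: "\<exists>z\<in>reps U U. teq (reg_mod U) (reg_mod U) (gal z) w" if "w \<in> reps U U" for w
    using hopf that unfolding times_hopf_def UU_eq_teq by blast
  have \<phi>_hom: "mod_hom (op_ring A) ?V (reg_mod (op_ring A)) (\<phi> j)"
    and c_hom: "mod_hom (op_ring A) (reg_mod (op_ring A)) ?V (c j)" if "j \<in> K" for j
    using dec that by (auto simp: decomposes_through_def)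
  have \<phi>: "\<phi> j v \<in> carrier A" "\<phi> j (v \<oplus>\<^bsub>U\<^esub> w) = \<phi> j v \<oplus>\<^bsub>A\<^esub> \<phi> j w"
      "a \<in> carrier A \<Longrightarrow> \<phi> j (t a \<otimes>\<^bsub>U\<^esub> v) = \<phi> j v \<otimes>\<^bsub>A\<^esub> a"
    if "j \<in> K" "v \<in> carrier U" "w \<in> carrier U" for j v w a
    using \<phi>_hom[OF that(1)] that by (auto simp: mod_hom_def)
  \<comment> \<open>The basis element \<open>e\<^sub>j\<close> is \<open>c j\<close> at one. In the
    opposite ring \<open>a\<close> times one is still \<open>a\<close>, so linearity recovers
    \<open>c j\<close> from this single value.\<close>
  have e: "c j \<one>\<^bsub>A\<^esub> \<in> carrier U" "a \<in> carrier A \<Longrightarrow> c j a = t a \<otimes>\<^bsub>U\<^esub> c j \<one>\<^bsub>A\<^esub>" if "j \<in> K" for j a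
    using mod_hom_smult[OF c_hom[OF that], of a "\<one>\<^bsub>A\<^esub>"] additiveD(1)[OF mod_hom_additive[OF c_hom[OF that]]]
    by auto
  \<comment> \<open>This is \<open>id \<otimes> \<phi> j\<close> followed by the identification
    \<open>u \<otimes> a \<mapsto> u t(a)\<close> of \<open>U \<otimes> A\<close> with
    \<open>U\<close>.\<close>
  define \<Phi> where "\<Phi> j = feval U (\<lambda>(u, v). u \<otimes>\<^bsub>U\<^esub> t (\<phi> j v))" for j
  have \<Phi>_fun: "(\<lambda>(u, v). u \<otimes>\<^bsub>U\<^esub> t (\<phi> j v)) \<in> carrier U \<times> carrier U \<rightarrow> carrier U" if "j \<in> K" for j
    using \<phi>(1)[OF that] by auto
  have \<Phi>_closed: "\<Phi> j z \<in> carrier U" if "j \<in> K" "z \<in> reps U U" for j z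
    unfolding \<Phi>_def by (rule U.feval_closed[OF that(2) \<Phi>_fun[OF that(1)]])
  \<comment> \<open>Two reversals of order cancel in the balancing relation:
    \<open>\<phi> j (t a v) = \<phi> j v a\<close> by right linearity, and antimultiplicativity of
    \<open>t\<close> turns this into \<open>t a\<close> times \<open>t (\<phi> j v)\<close>.\<close>
  have \<Phi>_cong: "\<Phi> j z = \<Phi> j z'" if j: "j \<in> K" and eq: "UopU_eq A U t z z'" for j z z'
    unfolding \<Phi>_def
    by (rule tens_eq_feval[OF eq[unfolded UopU_eq_def] U.abelian_group_axioms])
       (use \<phi>[OF j] in \<open>auto simp: U.abelian_group_axioms U.l_distr U.r_distr t_add t_mult U.m_assoc\<close>)
  have \<Phi>_mult: "\<Phi> j (fmap2 (\<lambda>x. u \<otimes>\<^bsub>U\<^esub> x) (\<lambda>y. y) z) = u \<otimes>\<^bsub>U\<^esub> \<Phi> j z"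
    if j: "j \<in> K" and u: "u \<in> carrier U" and z: "z \<in> reps U U" for j u z
    using z
  proof (induction rule: free_ab_induct)
    case (diff x y)
    have cl: "fmap2 (\<lambda>x. u \<otimes>\<^bsub>U\<^esub> x) (\<lambda>y. y) w \<in> reps U U" if "w \<in> reps U U" for w
      using that by (rule fmap2_closed) (use u in auto)
    note d = U.feval_fdiff[OF _ _ \<Phi>_fun[OF j], folded \<Phi>_def]
    show ?case
      using diff u \<Phi>_closed[OF j]
      by (simp add: fmap2_fdiff[OF diff.hyps] d cl a_minus_def U.r_distr U.r_minus)
  qed (use u \<phi>(1)[OF j] in \<open>auto simp: \<Phi>_def U.m_assoc\<close>)
  \<comment> \<open>The inverse of the Galois map is taken by choosing any formal sum whose image
    lies in the class \<open>X\<close>; by \<open>inj\<close> and \<open>\<Phi>_cong\<close> the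
    value does not depend on the choice.\<close>
  define h where "h j X = \<Phi> j (SOME z. z \<in> reps U U \<and> gal z \<in> X)" for j X
  define b where "b j r = r \<odot>\<^bsub>UU\<^esub> UUcls (fdelta (\<one>\<^bsub>U\<^esub>, c j \<one>\<^bsub>A\<^esub>))" for j r
  have gc: "UUcls (gal z) \<in> carrier UU" if "z \<in> reps U U" for z
    using gal_closed[OF that] by (simp add: cls_closed[OF reg])
  have h: "h j (UUcls (gal z)) = \<Phi> j z" if j: "j \<in> K" and z: "z \<in> reps U U" for j z
  proof -
    let ?w = "SOME w. w \<in> reps U U \<and> gal w \<in> UUcls (gal z)"
    have "?w \<in> reps U U \<and> gal ?w \<in> UUcls (gal z)"
      by (rule someI[of "\<lambda>w. w \<in> reps U U \<and> gal w \<in> UUcls (gal z)" z])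
         (use z gal_closed[OF z] in \<open>auto simp: cls_def intro: teq_refl\<close>)
    then have "UopU_eq A U t z ?w" using z by (intro inj) (auto simp: cls_def)
    then show ?thesis unfolding h_def using \<Phi>_cong[OF j] by simp
  qed
  have gal_rep: "\<exists>z\<in>reps U U. X = UUcls (gal z)" if X: "X \<in> carrier UU" for X
  proof -
    obtain w where w: "w \<in> reps U U" "X = UUcls w"
      using X by (auto simp: ten_carrier[OF reg])
    with surj[OF w(1)] show ?thesis
      by (metis cls_eq_iff[OF reg] gal_closed reg_mod_simps(1) teq_sym)
  qed
  have h_hom: "mod_hom U UU (reg_mod U) (h j)" if j: "j \<in> K" for j
    unfolding mod_hom_def
  proof (intro conjI ballI)
    show "h j \<in> carrier UU \<rightarrow> carrier (reg_mod U)"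
      using gal_rep h[OF j] \<Phi>_closed[OF j] by fastforce
  next
    fix X Y assume "X \<in> carrier UU" "Y \<in> carrier UU"
    then obtain x y where x: "x \<in> reps U U" "X = UUcls (gal x)" and y: "y \<in> reps U U" "Y = UUcls (gal y)"
      using gal_rep by meson
    have "X \<oplus>\<^bsub>UU\<^esub> Y = UUcls (gal (fadd x y))"
      using x y gal_closed by (simp add: ten_add[OF reg] gal_fadd)
    then show "h j (X \<oplus>\<^bsub>UU\<^esub> Y) = h j X \<oplus>\<^bsub>reg_mod U\<^esub> h j Y"
      using x y U.feval_fadd[OF x(1) y(1) \<Phi>_fun[OF j], folded \<Phi>_def] by (simp add: h[OF j])
  next
    fix u X assume u: "u \<in> carrier U" and "X \<in> carrier UU"
    then obtain x where x: "x \<in> reps U U" "X = UUcls (gal x)" using gal_rep by meson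
    let ?ux = "fmap2 (\<lambda>x. u \<otimes>\<^bsub>U\<^esub> x) (\<lambda>y. y) x"
    have ux: "?ux \<in> reps U U" by (rule fmap2_closed[OF x(1)]) (use u in auto)
    have "u \<odot>\<^bsub>UU\<^esub> X = UUcls (gal ?ux)"
      using teq_sym[OF gal_mult_left[OF u x(1)]] x u gal_closed[OF x(1)] gal_closed[OF ux]
      by (simp add: ten_smult[OF reg] cls_eq_iff[OF reg] act_closed[OF reg, unfolded reg_mod_simps])
    then show "h j (u \<odot>\<^bsub>UU\<^esub> X) = u \<odot>\<^bsub>reg_mod U\<^esub> h j X"
      using x ux \<Phi>_mult[OF j u x(1)] by (simp add: h[OF j])
  qed
  have e_pure: "UUcls (fdelta (\<one>\<^bsub>U\<^esub>, v)) \<in> carrier UU" if "v \<in> carrier U" for v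
    using that by (simp add: cls_closed[OF reg])
  have b_hom: "mod_hom U (reg_mod U) UU (b j)" if "j \<in> K" for j
    unfolding b_def using e(1)[OF that] by (intro mod_hom_reg_smult lmodule_ten reg e_pure)
  have "decomposes_at UU (reg_mod U) K h b (UUcls (gal z))" if "z \<in> reps U U" for z
    using that
  proof (induction rule: free_ab_induct)
    case zero
    show ?case
      unfolding gal_fzero ten_zero[OF reg, symmetric]
      by (rule decomposes_at_zero[OF grp mod_hom_additive[OF h_hom]])
  next
    case (diff x y)
    have "UUcls (gal (fdiff x y)) = UUcls (gal x) \<ominus>\<^bsub>UU\<^esub> UUcls (gal y)"
      using diff.hyps gal_closed by (simp add: gal_fdiff ten_diff[OF reg])
    then show ?case
      using decomposes_at_diff[OF grp mod_hom_additive[OF h_hom] mod_hom_additive[OF b_hom]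
          gc[OF diff.hyps(1)] gc[OF diff.hyps(2)] diff.IH]
      by simp
  next
    case (delta x)
    then obtain u v where x: "x = (u, v)" and u: "u \<in> carrier U" and v: "v \<in> carrier U" by auto
    obtain L where L: "finite L" "L \<subseteq> K" "\<And>j. j \<in> K - L \<Longrightarrow> \<phi> j v = \<zero>\<^bsub>A\<^esub>"
        "v = finsum ?V (\<lambda>j. c j (\<phi> j v)) L"
      using dec v unfolding decomposes_through_def decomposes_at_def by auto
    have hx: "h j (UUcls (gal (fdelta x))) = u \<otimes>\<^bsub>U\<^esub> t (\<phi> j v)" if "j \<in> K" for j
      using h[OF that, of "fdelta x"] delta u v \<phi>(1)[OF that v] by (simp add: x \<Phi>_def)
    have cv: "c j (\<phi> j v) \<in> carrier U" if "j \<in> L" for j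
      using that L(2) \<phi>(1) v additiveD(1)[OF mod_hom_additive[OF c_hom]] by auto
    \<comment> \<open>Additivity in \<open>y\<close> suffices to insert the expansion of
      \<open>v\<close>; the coefficients are pulled out afterwards.\<close>
    have addp: "additive ?V UU (\<lambda>y. u \<odot>\<^bsub>UU\<^esub> UUcls (fdelta (\<one>\<^bsub>U\<^esub>, y)))"
      using additive_pure_right[OF reg, of "\<one>\<^bsub>U\<^esub>"] additive_smult_right[OF lmodule_ten[OF reg] u]
      by (simp add: additive_def Pi_iff)
    have "UUcls (gal (fdelta x)) = u \<odot>\<^bsub>UU\<^esub> UUcls (fdelta (\<one>\<^bsub>U\<^esub>, v))"
      using u v by (simp add: x gal_fdelta ten_smult[OF reg])
    also have "\<dots> = finsum UU (\<lambda>j. u \<odot>\<^bsub>UU\<^esub> UUcls (fdelta (\<one>\<^bsub>U\<^esub>, c j (\<phi> j v)))) L"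
      by (subst L(4), rule additive_finsum[OF grpV grp(1) addp L(1)]) (use cv in auto)
    also have "\<dots> = finsum UU (\<lambda>j. b j (h j (UUcls (gal (fdelta x))))) L"
    proof (rule T.finsum_cong'[OF refl])
      \<comment> \<open>With \<open>e\<^sub>j = c j 1\<close>, the term
        \<open>u (1 \<otimes> t(\<phi> j v) e\<^sub>j)\<close> equals
        \<open>(u t(\<phi> j v)) (1 \<otimes> e\<^sub>j)\<close>, and the scalar is the value of
        \<open>h j\<close> on the class of \<open>gal (fdelta x)\<close>.\<close>
      fix j assume "j \<in> L"
      then have j: "j \<in> K" using L(2) by auto
      show "u \<odot>\<^bsub>UU\<^esub> UUcls (fdelta (\<one>\<^bsub>U\<^esub>, c j (\<phi> j v))) = b j (h j (UUcls (gal (fdelta x))))"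
        using u \<phi>(1)[OF j v v] e(1)[OF j] e(2)[OF j \<phi>(1)[OF j v v]] e_pure[OF e(1)[OF j]]
        by (simp add: hx[OF j] b_def smult_t_pure[symmetric] lmoduleD(6)[OF lmodule_ten[OF reg]])
    next
      show "(\<lambda>j. b j (h j (UUcls (gal (fdelta x))))) \<in> L \<rightarrow> carrier UU"
        using L(2) additiveD(1)[OF mod_hom_additive[OF b_hom]] additiveD(1)[OF mod_hom_additive[OF h_hom]]
          gc[of "fdelta x"] delta by auto
    qed
    finally have "UUcls (gal (fdelta x)) = finsum UU (\<lambda>j. b j (h j (UUcls (gal (fdelta x))))) L" .
    moreover have "h j (UUcls (gal (fdelta x))) = \<zero>\<^bsub>reg_mod U\<^esub>" if "j \<in> K - L" for j
    proof -
      have "t \<zero>\<^bsub>A\<^esub> = \<zero>\<^bsub>U\<^esub>"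
        by (rule additive_zero[OF A.abelian_group_axioms U.abelian_group_axioms])
           (simp add: additive_def t_add)
      then show ?thesis using that hx L(3) u by simp
    qed
    ultimately show ?case unfolding decomposes_at_def using L(1,2) by blast
  qed
  then have "decomposes_through U UU (reg_mod U) K h b"
    unfolding decomposes_through_def using h_hom b_hom gal_rep by blast
  then show ?thesis by (rule that)
qed

end

theorem theorem3p5:
  fixes k :: "'k ring" and A :: "'a ring" and U :: "'u ring"
    and iA :: "'k \<Rightarrow> 'a" and iU :: "'k \<Rightarrow> 'u" and s t :: "'a \<Rightarrow> 'u"
    and delta :: "'u \<Rightarrow> 'u \<times> 'u \<Rightarrow> int" and epsh :: "'u \<Rightarrow> 'a \<Rightarrow> 'a"
    and P :: "('u, 'p) module" and Q :: "('u, 'q) module"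
  assumes "times_hopf k A U iA iU s t delta epsh"
    and "rprojective A (U_rtri A U t)"
    and "lprojective U P" and "lprojective U Q"
  shows "lprojective U (tensor_mod A s t delta P Q)"
proof -
  interpret bialgebroid k A U iA iU s t delta epsh
    using assms(1) by unfold_locales (simp add: times_hopf_def)
  have P: "lmodule U P" and Q: "lmodule U Q"
    using assms(3,4) by (auto simp: lprojective_def)
  obtain I :: "'p set" and a b where "decomposes_through U P (reg_mod U) I a b"
    using lprojective_imp_decomposes_through[OF assms(3)] .
  moreover obtain J :: "'q set" and c d where "decomposes_through U Q (reg_mod U) J c d"
    using lprojective_imp_decomposes_through[OF assms(4)] .
  ultimately have PQ: "decomposes_through U (ten P Q) UU (I \<times> J)
      (\<lambda>(j, k). tmap (reg_mod U) (reg_mod U) (a j) (c k)) (\<lambda>(j, k). tmap P Q (b j) (d k))"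
    by (rule decomposes_through_ten[OF P lmodule_U Q lmodule_U])
  obtain K :: "'u set" and \<phi> e
    where "decomposes_through (op_ring A) (U_rtri A U t) (reg_mod (op_ring A)) K \<phi> e"
    using lprojective_imp_decomposes_through[OF rprojective_imp_lprojective_op_ring[OF assms(2)]] .
  then obtain h f where "decomposes_through U UU (reg_mod U) K h f"
    using decomposes_through_UU[OF assms(1)] by blast
  \<comment> \<open>The composite splitting is indexed by \<open>(I \<times> J) \<times> K\<close>,
    whose type is not that of the elements of the tensor product; the reindexing by basis elements
    takes care of this.\<close>
  from decomposes_through_trans[OF _ _ _ PQ this] show ?thesis
    by (rule lprojective_if_decomposes_through[OF lmodule_ten[OF P Q]])
       (auto intro: abelian_group_ten P Q lmodule_U lmoduleD(2))
qed

end
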